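(* Let $K$ be a field, $n\ge 1$, $S=K[x_1,\ldots,x_n]$ with the standard grading, and let $2\le s\le n$. Let $\alpha: a_1<a_2<\cdots<a_s$ and $\beta: b_1<b_2<\cdots<b_s$ be sequences of integers with $1\le a_1$, $b_s\le n$ and $a_i\le b_i$ for all $1\le i\le s$. Let $j=\max\{i: a_i\le b_1\}$, let $u=x_{a_1}x_{a_1+1}\cdots x_{b_1}$, and let $I=I_{\alpha,\beta}$, $\bar I=I_{\bar\alpha,\bar\beta}$, $I'=I_{\alpha',\beta'}$ and (when $j>1$) $I''=I_{\alpha'',\beta''}$ be the ideals defined in the context. Then for all integers $i,t>0$: (1) If $j=1$, then $\beta_{it}(I)=\beta_{it}((u))+\beta_{it}(I')+\beta_{i-1,t-\deg(u)}(I')$. (2) If $j>1$, then $\beta_{it}(I)=\beta_{it}((u))+\beta_{it}(\bar I)+\beta_{i-1,t-\deg(u)}(I'')$.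
   Context: For sequences $\alpha: a_1<\cdots<a_s$, $\beta: b_1<\cdots<b_s$ with $1\le a_1$, $b_s\le n$, $a_i\le b_i$, the ideal is $I_{\alpha,\beta}=(x_{a_1}x_{a_1+1}\cdots x_{b_1},\ldots,x_{a_s}x_{a_s+1}\cdots x_{b_s})\subset S$, with $I_{\alpha,\beta}=0$ for empty sequences. The graded Betti numbers of a homogeneous ideal $J\subset S$ are $\beta_{it}(J)=\dim_K\operatorname{Tor}^S_i(J,K)_t$ (zero for negative $t$). Derived sequences: $\bar\alpha: a_2<a_3<\cdots<a_s$ and $\bar\beta: b_2<b_3<\cdots<b_s$. With $j=\max\{i: a_i\le b_1\}$, let $\alpha': a_{j+1}<a_{j+2}<\cdots<a_s$ and $\beta': b_{j+1}<b_{j+2}<\cdots<b_s$ (both of length $s-j$, empty if $j=s$). If $j>1$, define $\alpha'',\beta''$ as follows. If $j<s$ and $a_{j+1}>b_1+1$: $\alpha'': b_1+1<a_{j+1}<a_{j+2}<\cdots<a_s$ and $\beta'': b_2<b_{j+1}<b_{j+2}<\cdots<b_s$. If $j<s$ and $a_{j+1}=b_1+1$: $\alpha'': b_1+1<a_{j+2}<\cdots<a_s$ and $\beta'': b_2<b_{j+2}<\cdots<b_s$. If $j=s$: $\alpha''$ and $\beta''$ are the one-term sequences $b_1+1$ and $b_2$. *)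

theory Defs
  imports "HOL-Library.Poly_Mapping"
begin

text \<open>Exponent vectors are finitely supported maps from variable indices to exponents.
  The ring \<open>K[x_1, ..., x_n]\<close> is the carrier \<open>S n\<close> of those polynomials
  in which only the variables with index in \<open>{1..n}\<close> occur.\<close>

type_synonym 'k mpoly = "(nat \<Rightarrow>\<^sub>0 nat) \<Rightarrow>\<^sub>0 'k"

definition S :: "nat \<Rightarrow> 'k::field mpoly set" where
  "S n = {p. \<forall>m\<in>Poly_Mapping.keys p. Poly_Mapping.keys m \<subseteq> {1..n}}"

definition const :: "'k::field \<Rightarrow> 'k mpoly" where
  "const c = Poly_Mapping.single 0 c"

definition var :: "nat \<Rightarrow> 'k::field mpoly" where
  "var i = Poly_Mapping.single (Poly_Mapping.single i 1) 1"

definition mon_deg :: "(nat \<Rightarrow>\<^sub>0 nat) \<Rightarrow> nat" where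
  "mon_deg m = (\<Sum>i\<in>Poly_Mapping.keys m. Poly_Mapping.lookup m i)"

definition poly_deg :: "'k::field mpoly \<Rightarrow> nat" where
  "poly_deg p = Max (insert 0 (mon_deg ` Poly_Mapping.keys p))"

text \<open>The zero polynomial is homogeneous of every degree, and it is the only polynomial
  that is homogeneous of a negative degree.\<close>

definition homogeneous :: "int \<Rightarrow> 'k::field mpoly \<Rightarrow> bool" where
  "homogeneous d p \<longleftrightarrow> (\<forall>m\<in>Poly_Mapping.keys p. int (mon_deg m) = d)"

definition is_ideal :: "nat \<Rightarrow> 'k::field mpoly set \<Rightarrow> bool" where
  "is_ideal n J \<longleftrightarrow> J \<subseteq> S n \<and> 0 \<in> J \<and> (\<forall>p\<in>J. \<forall>q\<in>J. p + q \<in> J) \<and> (\<forall>r\<in>S n. \<forall>p\<in>J. r * p \<in> J)"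

definition ideal_gen :: "nat \<Rightarrow> 'k::field mpoly set \<Rightarrow> 'k mpoly set" where
  "ideal_gen n G = \<Inter>{J. is_ideal n J \<and> G \<subseteq> J}"

text \<open>A complex \<open>... \<rightarrow> P_2 \<rightarrow> P_1 \<rightarrow> P_0 \<rightarrow> K \<rightarrow> 0\<close> with \<open>P_i\<close> a graded free
  \<open>S\<close>-module of finite rank is given by:
  \<^item> the ranks \<open>rk i\<close> and the degrees \<open>gdeg i b\<close> of the basis elements \<open>e_b\<close>
    (\<open>b < rk i\<close>) of \<open>P_i\<close>;
  \<^item> the matrices \<open>dmat i\<close> of the differentials \<open>P_(i+1) \<rightarrow> P_i\<close>,
    that is, \<open>e_b\<close> is sent to the sum of the \<open>dmat i b c * e_c\<close> over \<open>c < rk i\<close>;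
  \<^item> the images \<open>aug b\<close> in \<open>K\<close> of the basis elements of \<open>P_0\<close>.
  An element of a free module is identified with its coordinate function, which is zero
  from the rank onwards.\<close>

record (overloaded) 'k free_complex =
  rk :: "nat \<Rightarrow> nat"
  gdeg :: "nat \<Rightarrow> nat \<Rightarrow> int"
  dmat :: "nat \<Rightarrow> nat \<Rightarrow> nat \<Rightarrow> 'k mpoly"
  aug :: "nat \<Rightarrow> 'k"

text \<open>For an ideal \<open>J\<close>, \<open>J \<otimes>_S P_i\<close> is the direct sum of \<open>rk i\<close> copies of \<open>J\<close>;
  with \<open>J = S n\<close> this is \<open>P_i\<close> itself.\<close>

definition tensor :: "'k::field mpoly set \<Rightarrow> 'k free_complex \<Rightarrow> nat \<Rightarrow> (nat \<Rightarrow> 'k mpoly) set" where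
  "tensor J P i = {v. (\<forall>b<rk P i. v b \<in> J) \<and> (\<forall>b\<ge>rk P i. v b = 0)}"

definition tensor_deg ::
    "'k::field mpoly set \<Rightarrow> 'k free_complex \<Rightarrow> nat \<Rightarrow> int \<Rightarrow> (nat \<Rightarrow> 'k mpoly) set" where
  "tensor_deg J P i t = {v \<in> tensor J P i. \<forall>b<rk P i. homogeneous (t - gdeg P i b) (v b)}"

definition diff :: "'k::field free_complex \<Rightarrow> nat \<Rightarrow> (nat \<Rightarrow> 'k mpoly) \<Rightarrow> nat \<Rightarrow> 'k mpoly" where
  "diff P i v = (\<lambda>c. if c < rk P i then \<Sum>b<rk P (Suc i). v b * dmat P i b c else 0)"

text \<open>\<open>S\<close> acts on \<open>K = S/(x_1, ..., x_n)\<close> through the constant coefficient.\<close>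

definition augment :: "'k::field free_complex \<Rightarrow> (nat \<Rightarrow> 'k mpoly) \<Rightarrow> 'k" where
  "augment P v = (\<Sum>b<rk P 0. Poly_Mapping.lookup (v b) 0 * aug P b)"

text \<open>\<open>K\<close> is concentrated in degree 0, and all maps are homogeneous of degree 0.\<close>

definition graded_free_resolution :: "nat \<Rightarrow> 'k::field free_complex \<Rightarrow> bool" where
  "graded_free_resolution n P \<longleftrightarrow>
     (\<forall>i. \<forall>b<rk P (Suc i). \<forall>c<rk P i.
        dmat P i b c \<in> S n \<and> homogeneous (gdeg P (Suc i) b - gdeg P i c) (dmat P i b c)) \<and>
     (\<forall>b<rk P 0. gdeg P 0 b \<noteq> 0 \<longrightarrow> aug P b = 0) \<and>
     augment P ` tensor (S n) P 0 = UNIV \<and>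
     {v \<in> tensor (S n) P 0. augment P v = 0} = diff P 0 ` tensor (S n) P 1 \<and>
     (\<forall>i. {v \<in> tensor (S n) P (Suc i). diff P i v = (\<lambda>_. 0)} =
        diff P (Suc i) ` tensor (S n) P (Suc (Suc i)))"

definition cycles ::
    "'k::field free_complex \<Rightarrow> 'k mpoly set \<Rightarrow> nat \<Rightarrow> int \<Rightarrow> (nat \<Rightarrow> 'k mpoly) set" where
  "cycles P J i t = {v \<in> tensor_deg J P i t. i = 0 \<or> diff P (i - 1) v = (\<lambda>_. 0)}"

definition boundaries ::
    "'k::field free_complex \<Rightarrow> 'k mpoly set \<Rightarrow> nat \<Rightarrow> int \<Rightarrow> (nat \<Rightarrow> 'k mpoly) set" where
  "boundaries P J i t = diff P i ` tensor_deg J P (Suc i) t"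

text \<open>\<open>C\<close> is mapped bijectively onto a \<open>K\<close>-basis of \<open>Z/B\<close>.\<close>

definition finite_quotient_basis ::
    "(nat \<Rightarrow> 'k::field mpoly) set \<Rightarrow> (nat \<Rightarrow> 'k mpoly) set \<Rightarrow> (nat \<Rightarrow> 'k mpoly) set \<Rightarrow> bool" where
  "finite_quotient_basis Z B C \<longleftrightarrow> finite C \<and> C \<subseteq> Z \<and>
     (\<forall>z\<in>Z. \<exists>a. (\<lambda>b. z b - (\<Sum>v\<in>C. const (a v) * v b)) \<in> B) \<and>
     (\<forall>a. (\<lambda>b. \<Sum>v\<in>C. const (a v) * v b) \<in> B \<longrightarrow> (\<forall>v\<in>C. a v = 0))"

definition quotient_dim ::
    "(nat \<Rightarrow> 'k::field mpoly) set \<Rightarrow> (nat \<Rightarrow> 'k mpoly) set \<Rightarrow> nat" where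
  "quotient_dim Z B = (THE d. \<exists>C. finite_quotient_basis Z B C \<and> card C = d)"

text \<open>\<open>Tor_i(J, K)\<close> is the homology in position \<open>i\<close> of \<open>J \<otimes> P\<close> for a graded free
  resolution \<open>P\<close> of \<open>K\<close>, independently of its choice (the Koszul complex is one of finite
  rank), and \<open>betti n J i t\<close> is the \<open>K\<close>-dimension of its component of degree \<open>t\<close>,
  for \<open>J\<close> a homogeneous ideal of \<open>S n\<close>. This component is finite-dimensional
  because the ranks are finite. It is zero for negative \<open>t\<close>.\<close>

definition betti :: "nat \<Rightarrow> 'k::field mpoly set \<Rightarrow> nat \<Rightarrow> int \<Rightarrow> nat" where
  "betti n J i t =
     (let P = (SOME P. graded_free_resolution n P)
      in quotient_dim (cycles P J i t) (boundaries P J i t))"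

text \<open>A sequence \<open>a_1 < ... < a_s\<close> is a list, so that \<open>a_i\<close> is \<open>\<alpha> ! (i - 1)\<close>.\<close>

definition interval_monom :: "nat \<Rightarrow> nat \<Rightarrow> 'k::field mpoly" where
  "interval_monom a b = (\<Prod>i\<in>{a..b}. var i)"

definition seq_ideal :: "nat \<Rightarrow> nat list \<Rightarrow> nat list \<Rightarrow> 'k::field mpoly set" where
  "seq_ideal n \<alpha> \<beta> = ideal_gen n {interval_monom (\<alpha> ! k) (\<beta> ! k) | k. k < length \<alpha>}"

definition overlap_index :: "nat list \<Rightarrow> nat list \<Rightarrow> nat" where
  "overlap_index \<alpha> \<beta> = Max {i \<in> {1..length \<alpha>}. \<alpha> ! (i - 1) \<le> \<beta> ! 0}"

definition alpha' :: "nat list \<Rightarrow> nat list \<Rightarrow> nat list" where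
  "alpha' \<alpha> \<beta> = drop (overlap_index \<alpha> \<beta>) \<alpha>"

definition beta' :: "nat list \<Rightarrow> nat list \<Rightarrow> nat list" where
  "beta' \<alpha> \<beta> = drop (overlap_index \<alpha> \<beta>) \<beta>"

text \<open>With \<open>j\<close> the overlap index, \<open>\<alpha> ! j\<close> is \<open>a_(j+1)\<close> and \<open>\<beta> ! 1\<close> is \<open>b_2\<close>.
  The two sequences below are meaningful only if \<open>j > 1\<close>.\<close>

definition alpha'' :: "nat list \<Rightarrow> nat list \<Rightarrow> nat list" where
  "alpha'' \<alpha> \<beta> =
     (let j = overlap_index \<alpha> \<beta>; b1 = \<beta> ! 0 in
      if j < length \<alpha>
      then (if \<alpha> ! j > b1 + 1 then (b1 + 1) # drop j \<alpha> else (b1 + 1) # drop (j + 1) \<alpha>)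
      else [b1 + 1])"

definition beta'' :: "nat list \<Rightarrow> nat list \<Rightarrow> nat list" where
  "beta'' \<alpha> \<beta> =
     (let j = overlap_index \<alpha> \<beta>; b1 = \<beta> ! 0; b2 = \<beta> ! 1 in
      if j < length \<alpha>
      then (if \<alpha> ! j > b1 + 1 then b2 # drop j \<beta> else b2 # drop (j + 1) \<beta>)
      else [b2])"

end

theory Submission
  imports Defs "HOL-Library.Function_Algebras" "HOL.Vector_Spaces"
begin

text \<open>
  Write \<open>X = (u)\<close> and \<open>Y = I\<close>-bar, so that \<open>I = X + Y\<close>. Then
  \<open>X \<inter> Y = u (Y : u)\<close>, and the colon ideal \<open>Y : u\<close> is generated by the interval monomials of
  \<open>Y\<close> with the variables \<open>x_(a_1), ..., x_(b_1)\<close> removed. The intervals starting after \<open>b_1\<close> do not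
  change; the others become \<open>b_1 + 1, ..., b_k\<close> with \<open>2 \<le> k \<le> j\<close>, and the one with \<open>k = 2\<close> makes
  the rest superfluous, as well as the interval from \<open>a_(j+1)\<close> if \<open>a_(j+1) = b_1 + 1\<close>. So
  \<open>Y : u\<close> is \<open>I'\<close> for \<open>j = 1\<close> and \<open>I''\<close> for \<open>j > 1\<close>, and multiplication by \<open>u\<close> identifies
  \<open>Tor_(i-1)(Y : u, K)\<close> in degree \<open>t - deg u\<close> with \<open>Tor_(i-1)(X \<inter> Y, K)\<close> in degree \<open>t\<close>. Both formulas thus say that \<open>I = X + Y\<close> is a Betti splitting: the long exact Tor
  sequence of \<open>0 \<rightarrow> X \<inter> Y \<rightarrow> X \<oplus> Y \<rightarrow> I \<rightarrow> 0\<close> breaks into short exact sequences. For this the maps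
  induced on Tor by the inclusions of \<open>X \<inter> Y\<close> into \<open>X\<close> and into \<open>Y\<close> have to vanish.

  For \<open>Y\<close>: the variable \<open>x = x_(a_1)\<close> divides \<open>u\<close> but none of the generators of \<open>Y\<close>. Hence
  \<open>X \<inter> Y \<subseteq> x Y\<close>, and the inclusion factors through multiplication by \<open>x\<close> on \<open>Y\<close>. Multiplication by
  an element of the maximal ideal annihilates Tor with values in \<open>K\<close>, because on a resolution of
  \<open>K\<close> it lifts the zero map and so is null-homotopic (\<open>null_homotopy_on_cycles\<close>,
  \<open>multiple_of_cycle_is_boundary\<close>).

  For \<open>X\<close>: this ideal is free on \<open>u\<close>, so only \<open>Tor_0\<close> matters, and there the map is zero because
  \<open>X \<inter> Y = u (Y : u)\<close> with a proper ideal \<open>Y : u\<close>. Both vanishing statements are part of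
  \<open>tor_dim_support_ideal_splitting\<close>.

  In place of the long exact sequence, the dimensions of cycles and boundaries are compared
  directly (\<open>betti_splitting\<close>). Everything is done for an arbitrary graded free resolution of \<open>K\<close>,
  since \<open>betti\<close> speaks of an unspecified one; that there is one at all is shown by the Koszul
  complex, built as an iterated mapping cone (\<open>cone_resolves\<close>).
\<close>

section \<open>Dimensions of quotients of subspaces\<close>

context vector_space
begin

text \<open>This is \<open>finite_quotient_basis\<close> in an arbitrary vector space.\<close>

definition quotient_basis :: "'b set \<Rightarrow> 'b set \<Rightarrow> 'b set \<Rightarrow> bool" where
  "quotient_basis Z B C \<longleftrightarrow> finite C \<and> C \<subseteq> Z \<and>
     (\<forall>z\<in>Z. \<exists>a. z - (\<Sum>v\<in>C. a v *s v) \<in> B) \<and>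
     (\<forall>a. (\<Sum>v\<in>C. a v *s v) \<in> B \<longrightarrow> (\<forall>v\<in>C. a v = 0))"

definition finite_dim :: "'b set \<Rightarrow> bool" where
  "finite_dim V \<longleftrightarrow> (\<exists>F. finite F \<and> V \<subseteq> span F)"

lemma finite_dim_subset: "finite_dim V \<Longrightarrow> W \<subseteq> V \<Longrightarrow> finite_dim W"
  unfolding finite_dim_def by blast

lemma independent_finite_of_finite_dim:
  assumes "finite_dim V" "independent B" "B \<subseteq> V"
  shows "finite B"
  using assms independent_span_bound unfolding finite_dim_def by (meson order_trans)

lemma finite_dim_linear_image:
  assumes "finite_dim V" "Vector_Spaces.linear scale scale f"
  shows "finite_dim (f ` V)"
proof -
  interpret f: linear scale scale f by fact
  obtain F where "finite F" "V \<subseteq> span F"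
    using assms unfolding finite_dim_def by blast
  then have "finite (f ` F)" "f ` V \<subseteq> span (f ` F)"
    using f.span_image by auto
  then show ?thesis unfolding finite_dim_def by blast
qed

text \<open>A quotient basis together with a basis of \<open>B\<close> is a basis of \<open>Z\<close>. So all quotient bases have
  the same size, which is what gives the definite description in \<open>quotient_dim\<close> its meaning.\<close>

lemma quotient_basis_card:
  assumes C: "quotient_basis Z B C" and fd: "finite_dim Z"
    and B: "subspace B" and Z: "subspace Z" and BZ: "B \<subseteq> Z"
  shows "card C + dim B = dim Z"
proof -
  obtain E where E: "E \<subseteq> B" "independent E" "B \<subseteq> span E" "card E = dim B"
    using basis_exists by blast
  have finE: "finite E"
    using independent_finite_of_finite_dim[OF fd E(2)] E(1) BZ by blast
  have finC: "finite C" and CZ: "C \<subseteq> Z"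
    and gen: "\<And>z. z \<in> Z \<Longrightarrow> \<exists>a. z - (\<Sum>v\<in>C. a v *s v) \<in> B"
    and ind: "\<And>a v. (\<Sum>v\<in>C. a v *s v) \<in> B \<Longrightarrow> v \<in> C \<Longrightarrow> a v = 0"
    using C unfolding quotient_basis_def by blast+
  have disj: "C \<inter> E = {}"
  proof (rule ccontr)
    assume "C \<inter> E \<noteq> {}"
    then obtain w where w: "w \<in> C" "w \<in> B" using E by auto
    have "(\<Sum>v\<in>C. (if v = w then 1 else 0) *s v) = w"
      using finC w by (simp add: if_distrib[of "\<lambda>c. scale c _"] sum.delta cong: if_cong)
    then show False using ind[of "\<lambda>v. if v = w then 1 else 0" w] w by simp
  qed
  have "independent (C \<union> E)"
  proof (rule independent_if_scalars_zero)
    show "finite (C \<union> E)" using finC finE by simp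
    fix a x assume 0: "(\<Sum>v\<in>C \<union> E. a v *s v) = 0" and x: "x \<in> C \<union> E"
    have s: "(\<Sum>v\<in>C. a v *s v) + (\<Sum>v\<in>E. a v *s v) = 0"
      using 0 sum.union_disjoint[OF finC finE disj] by metis
    have eB: "(\<Sum>v\<in>E. a v *s v) \<in> B"
      using E(1) B by (intro subspace_sum subspace_scale) auto
    have "(\<Sum>v\<in>C. a v *s v) = - (\<Sum>v\<in>E. a v *s v)"
      using s by (simp add: add_eq_0_iff2)
    then have "(\<Sum>v\<in>C. a v *s v) \<in> B"
      using eB B subspace_neg by metis
    then have c0: "\<And>v. v \<in> C \<Longrightarrow> a v = 0" using ind by blast
    then have "(\<Sum>v\<in>E. a v *s v) = 0" using s by simp
    then have "\<And>v. v \<in> E \<Longrightarrow> a v = 0"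
      using E(2) finE independentD by blast
    then show "a x = 0" using x c0 by blast
  qed
  moreover have "Z \<subseteq> span (C \<union> E)"
  proof
    fix z assume "z \<in> Z"
    then obtain a where a: "z - (\<Sum>v\<in>C. a v *s v) \<in> B" using gen by blast
    have "z - (\<Sum>v\<in>C. a v *s v) \<in> span (C \<union> E)"
      using a E(3) span_mono[of E "C \<union> E"] by blast
    moreover have "(\<Sum>v\<in>C. a v *s v) \<in> span (C \<union> E)"
      by (intro span_sum span_scale span_base) auto
    ultimately show "z \<in> span (C \<union> E)"
      using span_add by fastforce
  qed
  moreover have "C \<union> E \<subseteq> Z" using CZ E(1) BZ by blast
  ultimately have "card (C \<union> E) = dim Z" using basis_card_eq_dim by blast
  then show ?thesis using card_Un_disjoint[OF finC finE disj] E(4) by simp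
qed

lemma quotient_basis_exists:
  assumes fd: "finite_dim Z" and B: "subspace B" and Z: "subspace Z" and BZ: "B \<subseteq> Z"
  obtains C where "quotient_basis Z B C"
proof -
  obtain E where E: "E \<subseteq> B" "independent E" "B \<subseteq> span E" "card E = dim B"
    using basis_exists by blast
  obtain F where F: "E \<subseteq> F" "F \<subseteq> Z" "independent F" "Z \<subseteq> span F"
    using maximal_independent_subset_extend[of E Z] E(1,2) BZ by blast
  have finF: "finite F" using independent_finite_of_finite_dim[OF fd F(3,2)] .
  have finE: "finite E" using finF F(1) finite_subset by blast
  have split: "(\<Sum>v\<in>F. a v *s v) = (\<Sum>v\<in>F - E. a v *s v) + (\<Sum>v\<in>E. a v *s v)" for a
    using sum.subset_diff[OF F(1) finF] by metis
  have "quotient_basis Z B (F - E)"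
    unfolding quotient_basis_def
  proof (intro conjI ballI allI impI)
    show "finite (F - E)" "F - E \<subseteq> Z" using finF F(2) by auto
    fix z assume "z \<in> Z"
    then obtain a where "z = (\<Sum>v\<in>F. a v *s v)"
      using F(4) span_finite[OF finF] by blast
    then have "z - (\<Sum>v\<in>F - E. a v *s v) = (\<Sum>v\<in>E. a v *s v)" using split by simp
    also have "\<dots> \<in> B" using E(1) B by (intro subspace_sum subspace_scale) auto
    finally show "\<exists>a. z - (\<Sum>v\<in>F - E. a v *s v) \<in> B" by blast
  next
    fix a w assume a: "(\<Sum>v\<in>F - E. a v *s v) \<in> B" and w: "w \<in> F - E"
    obtain c where c: "(\<Sum>v\<in>F - E. a v *s v) = (\<Sum>v\<in>E. c v *s v)"
      using a E(3) span_finite[OF finE] by blast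
    define d where "d v = (if v \<in> E then - c v else a v)" for v
    have "(\<Sum>v\<in>F. d v *s v) = (\<Sum>v\<in>F - E. a v *s v) + (\<Sum>v\<in>E. - (c v *s v))"
      unfolding split d_def by (intro arg_cong2[of _ _ _ _ "(+)"] sum.cong) auto
    also have "\<dots> = 0" using c by (simp add: sum_negf)
    finally have "d w = 0"
      using independentD[OF F(3) finF subset_refl] w by blast
    then show "a w = 0" using w unfolding d_def by simp
  qed
  then show ?thesis using that by blast
qed

lemma dim_zero_subspace: "dim {0} = 0"
  using dim_unique[of "{}" "{0}" 0] independent_empty by simp

text \<open>Rank-nullity for a finite-dimensional subspace of a space that need not be
  finite-dimensional: a quotient basis modulo the kernel is mapped injectively onto a basis of the
  image.\<close>

lemma dim_kernel_plus_dim_image: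
  assumes f: "Vector_Spaces.linear scale scale f" and fd: "finite_dim V" and V: "subspace V"
  shows "dim {v \<in> V. f v = 0} + dim (f ` V) = dim V"
proof -
  interpret f: linear scale scale f by fact
  define K where "K = {v \<in> V. f v = 0}"
  have K: "subspace K" "K \<subseteq> V"
    using V unfolding K_def subspace_def by (auto simp: f.add f.scale f.zero)
  obtain C where C: "quotient_basis V K C"
    using quotient_basis_exists[OF fd K(1) V K(2)] .
  have finC: "finite C" and CV: "C \<subseteq> V"
    and gen: "\<And>z. z \<in> V \<Longrightarrow> \<exists>a. z - (\<Sum>v\<in>C. a v *s v) \<in> K"
    and ind: "\<And>a v. (\<Sum>v\<in>C. a v *s v) \<in> K \<Longrightarrow> v \<in> C \<Longrightarrow> a v = 0"
    using C unfolding quotient_basis_def by blast+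
  have fsum: "f (\<Sum>v\<in>C. a v *s v) = (\<Sum>v\<in>C. a v *s f v)" for a
    by (simp add: f.sum f.scale)
  have CV_sum: "(\<Sum>v\<in>C. a v *s v) \<in> V" for a
    using CV V by (intro subspace_sum subspace_scale) auto
  have inj: "inj_on f C"
  proof (rule inj_onI)
    fix x y assume xy: "x \<in> C" "y \<in> C" "f x = f y"
    show "x = y"
    proof (rule ccontr)
      assume "x \<noteq> y"
      define a where "a v = (if v = x then 1 else 0) - (if v = y then (1 :: 'a) else 0)" for v
      have "(\<Sum>v\<in>C. a v *s v) = x - y"
        unfolding a_def using finC xy
        by (simp add: scale_left_diff_distrib sum_subtractf
            if_distrib[of "\<lambda>c. scale c _"] sum.delta cong: if_cong)
      moreover have "x - y \<in> K"
        unfolding K_def using xy CV V by (auto simp: f.diff intro: subspace_diff)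
      ultimately have "a x = 0" using ind[of a x] xy by simp
      then show False using \<open>x \<noteq> y\<close> unfolding a_def by simp
    qed
  qed
  have resum: "(\<Sum>w\<in>f ` C. a w *s w) = f (\<Sum>v\<in>C. a (f v) *s v)" for a
    unfolding fsum using sum.reindex[OF inj, of "\<lambda>w. a w *s w"] by (simp add: o_def)
  have "quotient_basis (f ` V) {0} (f ` C)"
    unfolding quotient_basis_def
  proof (intro conjI ballI allI impI)
    show "finite (f ` C)" "f ` C \<subseteq> f ` V" using finC CV by auto
    fix z assume "z \<in> f ` V"
    then obtain v where v: "v \<in> V" "z = f v" by blast
    obtain a where a: "v - (\<Sum>v\<in>C. a v *s v) \<in> K" using gen[OF v(1)] by blast
    define c where "c = a \<circ> inv_into C f"
    have "(\<Sum>v\<in>C. c (f v) *s v) = (\<Sum>v\<in>C. a v *s v)"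
      by (intro sum.cong) (auto simp: c_def inv_into_f_f[OF inj])
    then have "z - (\<Sum>w\<in>f ` C. c w *s w) = 0"
      using a unfolding resum v(2) K_def by (simp add: f.diff)
    then show "\<exists>a. z - (\<Sum>w\<in>f ` C. a w *s w) \<in> {0}" by blast
  next
    fix a w assume "(\<Sum>w\<in>f ` C. a w *s w) \<in> {0}" and w: "w \<in> f ` C"
    then have "(\<Sum>v\<in>C. a (f v) *s v) \<in> K" unfolding resum K_def using CV_sum by simp
    then show "a w = 0" using ind[of "\<lambda>v. a (f v)"] w by auto
  qed
  then have "card (f ` C) + dim {0} = dim (f ` V)"
    using finite_dim_linear_image[OF fd f] f.subspace_image[OF V] subspace_single_0 subspace_0
    by (intro quotient_basis_card) auto
  then have "card C = dim (f ` V)" using card_image[OF inj] dim_zero_subspace by simp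
  then show ?thesis using quotient_basis_card[OF C fd K(1) V K(2)] unfolding K_def by simp
qed

text \<open>A quotient basis of \<open>X\<close> modulo \<open>X \<inter> Y\<close> is also one of \<open>X + Y\<close> modulo \<open>Y\<close>.\<close>

lemma dim_sum_plus_dim_Int:
  assumes X: "subspace X" and Y: "subspace Y"
    and fd: "finite_dim {x + y | x y. x \<in> X \<and> y \<in> Y}"
  shows "dim {x + y | x y. x \<in> X \<and> y \<in> Y} + dim (X \<inter> Y) = dim X + dim Y"
proof -
  define W where "W = {x + y | x y. x \<in> X \<and> y \<in> Y}"
  have W: "subspace W" unfolding W_def using subspace_sums[OF X Y] .
  have XY: "subspace (X \<inter> Y)" using subspace_Int X Y by (simp add: subspace_inter)
  have XW: "X \<subseteq> W" unfolding W_def using subspace_0[OF Y] by force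
  have YW: "Y \<subseteq> W" unfolding W_def using subspace_0[OF X] by force
  have fdW: "finite_dim W" using fd unfolding W_def .
  have fdX: "finite_dim X" using finite_dim_subset[OF fdW XW] .
  obtain C where C: "quotient_basis X (X \<inter> Y) C"
    using quotient_basis_exists[OF fdX XY X] by blast
  have finC: "finite C" and CX: "C \<subseteq> X"
    and gen: "\<And>z. z \<in> X \<Longrightarrow> \<exists>a. z - (\<Sum>v\<in>C. a v *s v) \<in> X \<inter> Y"
    and ind: "\<And>a v. (\<Sum>v\<in>C. a v *s v) \<in> X \<inter> Y \<Longrightarrow> v \<in> C \<Longrightarrow> a v = 0"
    using C unfolding quotient_basis_def by blast+
  have "quotient_basis W Y C"
    unfolding quotient_basis_def
  proof (intro conjI ballI allI impI)
    show "finite C" "C \<subseteq> W" using finC CX XW by auto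
    fix z assume "z \<in> W"
    then obtain x y where z: "z = x + y" "x \<in> X" "y \<in> Y" unfolding W_def by blast
    obtain a where "x - (\<Sum>v\<in>C. a v *s v) \<in> Y" using gen[OF z(2)] by blast
    then have "(x - (\<Sum>v\<in>C. a v *s v)) + y \<in> Y" using subspace_add[OF Y] z by blast
    then show "\<exists>a. z - (\<Sum>v\<in>C. a v *s v) \<in> Y" unfolding z by (metis diff_add_eq)
  next
    fix a w assume a: "(\<Sum>v\<in>C. a v *s v) \<in> Y" and w: "w \<in> C"
    have "(\<Sum>v\<in>C. a v *s v) \<in> X"
      using CX X by (intro subspace_sum subspace_scale) auto
    then show "a w = 0" using ind[of a w] a w by blast
  qed
  then have "card C + dim Y = dim W" using quotient_basis_card fdW Y W YW by blast
  moreover have "card C + dim (X \<inter> Y) = dim X"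
    using quotient_basis_card[OF C fdX XY X] by blast
  ultimately show ?thesis unfolding W_def by simp
qed

lemma dim_injective_image:
  assumes f: "Vector_Spaces.linear scale scale f" and fd: "finite_dim V" and V: "subspace V"
    and inj: "\<And>v. v \<in> V \<Longrightarrow> f v = 0 \<Longrightarrow> v = 0"
  shows "dim (f ` V) = dim V"
proof -
  interpret f: linear scale scale f by fact
  have "{v \<in> V. f v = 0} = {0}" using inj subspace_0[OF V] f.zero by auto
  then show ?thesis using dim_kernel_plus_dim_image[OF f fd V] dim_zero_subspace by simp
qed

end

section \<open>Polynomials and their homogeneous components\<close>

lemma keys_add_monomial:
  "Poly_Mapping.keys (m + m' :: nat \<Rightarrow>\<^sub>0 nat) = Poly_Mapping.keys m \<union> Poly_Mapping.keys m'"
  by (auto simp: in_keys_iff lookup_add)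

lemma mon_deg_superset:
  assumes "finite A" "Poly_Mapping.keys m \<subseteq> A"
  shows "mon_deg m = (\<Sum>i\<in>A. Poly_Mapping.lookup m i)"
  unfolding mon_deg_def using assms
  by (intro sum.mono_neutral_left) (auto simp: in_keys_iff)

lemma mon_deg_add: "mon_deg (m + m') = mon_deg m + mon_deg m'"
proof -
  let ?A = "Poly_Mapping.keys m \<union> Poly_Mapping.keys m'"
  have "mon_deg (m + m') = (\<Sum>i\<in>?A. Poly_Mapping.lookup (m + m') i)"
    by (intro mon_deg_superset) (simp_all add: keys_add_monomial)
  also have "\<dots> = mon_deg m + mon_deg m'"
    using mon_deg_superset[of ?A m] mon_deg_superset[of ?A m']
    by (simp add: lookup_add sum.distrib)
  finally show ?thesis .
qed

lemma keys_multE: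
  fixes p q :: "'k::field mpoly"
  assumes "m \<in> Poly_Mapping.keys (p * q)"
  obtains a b where "m = a + b" "a \<in> Poly_Mapping.keys p" "b \<in> Poly_Mapping.keys q"
  using assms keys_mult[of p q] by blast

lemma keys_addE:
  fixes p q :: "'k::field mpoly"
  assumes "m \<in> Poly_Mapping.keys (p + q)"
  obtains "m \<in> Poly_Mapping.keys p" | "m \<in> Poly_Mapping.keys q"
  using assms Poly_Mapping.keys_add[of p q] by blast

lemma keys_uminus_poly: "Poly_Mapping.keys (- p :: 'k::field mpoly) = Poly_Mapping.keys p"
  by (auto simp: in_keys_iff)

lemma lookup_single_mult:
  fixes p :: "'k::field mpoly"
  shows "Poly_Mapping.lookup (Poly_Mapping.single m c * p) (m + k) = c * Poly_Mapping.lookup p k"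
  by (simp add: lookup_mult lookup_single when_mult)

lemma keys_single_mult:
  fixes p :: "'k::field mpoly"
  shows "Poly_Mapping.keys (Poly_Mapping.single m 1 * p) = (+) m ` Poly_Mapping.keys p"
proof
  show "(+) m ` Poly_Mapping.keys p \<subseteq> Poly_Mapping.keys (Poly_Mapping.single m 1 * p)"
    by (auto simp: in_keys_iff lookup_single_mult)
  show "Poly_Mapping.keys (Poly_Mapping.single m 1 * p) \<subseteq> (+) m ` Poly_Mapping.keys p"
    by (auto elim!: keys_multE split: if_splits)
qed

text \<open>The quotient is obtained by shifting all exponents down by \<open>m\<close>.\<close>

lemma monomial_divides_if_divides_all_terms:
  fixes p :: "'k::field mpoly"
  assumes "\<And>k. k \<in> Poly_Mapping.keys p \<Longrightarrow> \<exists>l. k = m + l"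
  obtains q where "p = Poly_Mapping.single m 1 * q"
proof -
  define q where "q = Poly_Mapping.map_key ((+) m) p"
  have q: "Poly_Mapping.lookup q l = Poly_Mapping.lookup p (m + l)" for l
    unfolding q_def by (simp add: map_key.rep_eq)
  have "Poly_Mapping.lookup p k = Poly_Mapping.lookup (Poly_Mapping.single m 1 * q) k" for k
  proof (cases "\<exists>l. k = m + l")
    case True
    then show ?thesis using q lookup_single_mult[of m 1 q] by auto
  next
    case False
    then have "k \<notin> Poly_Mapping.keys p" "k \<notin> Poly_Mapping.keys (Poly_Mapping.single m 1 * q)"
      using assms unfolding keys_single_mult by auto
    then show ?thesis by (simp add: in_keys_iff)
  qed
  then show ?thesis using that poly_mapping_eqI by blast
qed

definition sqfree_exponent :: "nat set \<Rightarrow> nat \<Rightarrow>\<^sub>0 nat" where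
  "sqfree_exponent A = (\<Sum>i\<in>A. Poly_Mapping.single i 1)"

lemma lookup_squarefree:
  assumes "finite A"
  shows "Poly_Mapping.lookup (sqfree_exponent A) i = (if i \<in> A then 1 else 0)"
  unfolding sqfree_exponent_def lookup_sum using assms
  by (simp add: lookup_single when_def)

lemma keys_squarefree: "finite A \<Longrightarrow> Poly_Mapping.keys (sqfree_exponent A) = A"
  by (auto simp: in_keys_iff lookup_squarefree split: if_splits)

lemma squarefree_divides:
  assumes "finite A" "A \<subseteq> Poly_Mapping.keys m"
  obtains l where "m = sqfree_exponent A + l"
proof
  show "m = sqfree_exponent A + (m - sqfree_exponent A)"
    using assms by (intro poly_mapping_eqI)
      (auto simp: lookup_add lookup_minus lookup_squarefree in_keys_iff)
qed

lemma prod_var: "finite A \<Longrightarrow> (\<Prod>i\<in>A. var i) = (Poly_Mapping.single (sqfree_exponent A) 1 :: 'k::field mpoly)"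
  by (induction A rule: finite_induct) (simp_all add: sqfree_exponent_def var_def mult_single)

lemma interval_monom_eq:
  "interval_monom a b = (Poly_Mapping.single (sqfree_exponent {a..b}) 1 :: 'k::field mpoly)"
  unfolding interval_monom_def by (rule prod_var) simp

lemma var_eq: "var i = (Poly_Mapping.single (sqfree_exponent {i}) 1 :: 'k::field mpoly)"
  unfolding var_def sqfree_exponent_def by simp

lemma poly_deg_monomial:
  "poly_deg (Poly_Mapping.single m 1 :: 'k::field mpoly) = mon_deg m"
  unfolding poly_deg_def by simp

subsection \<open>The polynomial ring in finitely many variables\<close>

lemma zero_in_S: "0 \<in> S n" unfolding S_def by simp
lemma const_in_S: "const c \<in> S n" unfolding S_def const_def by simp
lemma one_in_S: "1 \<in> S n" unfolding S_def by simp
lemma add_in_S: "p \<in> S n \<Longrightarrow> q \<in> S n \<Longrightarrow> p + q \<in> S n"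
  unfolding S_def by (auto elim!: keys_addE)
lemma uminus_in_S: "p \<in> S n \<Longrightarrow> - p \<in> S n"
  unfolding S_def by (simp add: keys_uminus_poly)
lemma mult_in_S: "p \<in> S n \<Longrightarrow> q \<in> S n \<Longrightarrow> p * q \<in> S n"
  unfolding S_def by (force elim!: keys_multE simp: keys_add_monomial)
lemma monomial_in_S: "Poly_Mapping.keys m \<subseteq> {1..n} \<Longrightarrow> Poly_Mapping.single m c \<in> S n"
  unfolding S_def by simp

lemma is_ideal_S: "is_ideal n (S n)"
  unfolding is_ideal_def using zero_in_S add_in_S mult_in_S by blast

context
  fixes n :: nat and J :: "'k::field mpoly set"
  assumes J: "is_ideal n J"
begin

lemma ideal_zero: "0 \<in> J" using J unfolding is_ideal_def by blast
lemma ideal_subset: "J \<subseteq> S n" using J unfolding is_ideal_def by blast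
lemma ideal_add: "p \<in> J \<Longrightarrow> q \<in> J \<Longrightarrow> p + q \<in> J" using J unfolding is_ideal_def by blast
lemma ideal_mult: "r \<in> S n \<Longrightarrow> p \<in> J \<Longrightarrow> r * p \<in> J" using J unfolding is_ideal_def by blast
lemma ideal_mult_right: "r \<in> S n \<Longrightarrow> p \<in> J \<Longrightarrow> p * r \<in> J"
  using ideal_mult by (subst mult.commute)
lemma ideal_uminus: "p \<in> J \<Longrightarrow> - p \<in> J"
  using ideal_mult[OF uminus_in_S[OF one_in_S]] by fastforce
lemma ideal_minus: "p \<in> J \<Longrightarrow> q \<in> J \<Longrightarrow> p - q \<in> J"
  using ideal_add[of p "- q"] ideal_uminus[of q] by simp
lemma ideal_sum: "(\<And>i. i \<in> A \<Longrightarrow> f i \<in> J) \<Longrightarrow> sum f A \<in> J"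
  by (induction A rule: infinite_finite_induct) (auto simp: ideal_zero ideal_add)

end

lemma homogeneous_zero: "homogeneous d 0" unfolding homogeneous_def by simp
lemma homogeneous_add: "homogeneous d p \<Longrightarrow> homogeneous d q \<Longrightarrow> homogeneous d (p + q)"
  unfolding homogeneous_def by (auto elim!: keys_addE)
lemma homogeneous_uminus: "homogeneous d p \<Longrightarrow> homogeneous d (- p)"
  unfolding homogeneous_def by (simp add: keys_uminus_poly)
lemma homogeneous_mult: "homogeneous d p \<Longrightarrow> homogeneous e q \<Longrightarrow> homogeneous (d + e) (p * q)"
  unfolding homogeneous_def by (auto elim!: keys_multE simp: mon_deg_add)
lemma homogeneous_sum: "(\<And>i. i \<in> A \<Longrightarrow> homogeneous d (f i)) \<Longrightarrow> homogeneous d (sum f A)"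
  by (induction A rule: infinite_finite_induct) (auto simp: homogeneous_zero homogeneous_add)
lemma homogeneous_monomial: "homogeneous (int (mon_deg m)) (Poly_Mapping.single m c)"
  unfolding homogeneous_def by simp

lemma homogeneous_monomial_mult_iff:
  "homogeneous d (Poly_Mapping.single m 1 * p) \<longleftrightarrow> homogeneous (d - int (mon_deg m)) p"
  unfolding homogeneous_def keys_single_mult by (auto simp: mon_deg_add)

subsection \<open>Selecting terms\<close>

definition part :: "((nat \<Rightarrow>\<^sub>0 nat) \<Rightarrow> bool) \<Rightarrow> 'k::field mpoly \<Rightarrow> 'k mpoly" where
  "part Q p = Poly_Mapping.mapp (\<lambda>m c. if Q m then c else 0) p"

lemma lookup_part:
  "Poly_Mapping.lookup (part Q p) m = (if Q m then Poly_Mapping.lookup p m else 0)"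
  unfolding part_def by (auto simp: lookup_mapp when_def in_keys_iff)

lemma keys_part: "Poly_Mapping.keys (part Q p) = {m \<in> Poly_Mapping.keys p. Q m}"
  by (auto simp: in_keys_iff lookup_part split: if_splits)

lemma part_in_S: "p \<in> S n \<Longrightarrow> part Q p \<in> S n"
  unfolding S_def by (simp add: keys_part)

lemma part_add: "part Q (p + q) = part Q p + part Q q"
  by (intro poly_mapping_eqI) (simp add: lookup_part lookup_add)

lemma part_zero: "part Q 0 = 0"
  by (intro poly_mapping_eqI) (simp add: lookup_part)

lemma part_sum: "part Q (sum f A) = (\<Sum>i\<in>A. part Q (f i))"
  by (induction A rule: infinite_finite_induct) (simp_all add: part_zero part_add)

lemma part_split: "p = part Q p + part (\<lambda>m. \<not> Q m) p"
  by (intro poly_mapping_eqI) (simp add: lookup_part lookup_add)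

lemma part_eq_self: "(\<And>m. m \<in> Poly_Mapping.keys p \<Longrightarrow> Q m) \<Longrightarrow> part Q p = p"
  by (intro poly_mapping_eqI) (auto simp: lookup_part in_keys_iff)

lemma part_eq_zero: "(\<And>m. m \<in> Poly_Mapping.keys p \<Longrightarrow> \<not> Q m) \<Longrightarrow> part Q p = 0"
  by (intro poly_mapping_eqI) (auto simp: lookup_part in_keys_iff)

definition hcomp :: "int \<Rightarrow> 'k::field mpoly \<Rightarrow> 'k mpoly" where
  "hcomp d = part (\<lambda>m. int (mon_deg m) = d)"

lemma homogeneous_hcomp: "homogeneous d (hcomp d p)"
  unfolding homogeneous_def hcomp_def by (simp add: keys_part)

lemma hcomp_homogeneous: "homogeneous d p \<Longrightarrow> hcomp d p = p"
  unfolding homogeneous_def hcomp_def by (intro part_eq_self) auto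

text \<open>Multiplication by a homogeneous polynomial shifts degrees, so it commutes with taking
  components. This makes the differentials of a graded complex respect degrees.\<close>

lemma hcomp_mult_homogeneous:
  assumes q: "homogeneous e q"
  shows "hcomp d (p * q) = hcomp (d - e) p * q"
proof -
  define r where "r = part (\<lambda>m. int (mon_deg m) \<noteq> d - e) p"
  have "p = hcomp (d - e) p + r" unfolding hcomp_def r_def by (rule part_split)
  then have "p * q = hcomp (d - e) p * q + r * q"
    by (simp flip: distrib_right)
  then have "hcomp d (p * q) = hcomp d (hcomp (d - e) p * q) + hcomp d (r * q)"
    unfolding hcomp_def[of d] by (simp only: part_add)
  also have "hcomp d (hcomp (d - e) p * q) = hcomp (d - e) p * q"
    using homogeneous_mult[OF homogeneous_hcomp q, of "d - e"] by (intro hcomp_homogeneous) simp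
  also have "hcomp d (r * q) = 0"
    unfolding hcomp_def
  proof (rule part_eq_zero)
    fix m assume "m \<in> Poly_Mapping.keys (r * q)"
    then obtain a b where "m = a + b" "a \<in> Poly_Mapping.keys r" "b \<in> Poly_Mapping.keys q"
      by (rule keys_multE)
    then show "int (mon_deg m) \<noteq> d"
      using q unfolding homogeneous_def r_def by (auto simp: keys_part mon_deg_add)
  qed
  finally show ?thesis by simp
qed

section \<open>Complexes of graded free modules\<close>

definition smul :: "'k::field mpoly \<Rightarrow> (nat \<Rightarrow> 'k mpoly) \<Rightarrow> nat \<Rightarrow> 'k mpoly" where
  "smul p v = (\<lambda>b. p * v b)"

definition cmul :: "'k::field \<Rightarrow> (nat \<Rightarrow> 'k mpoly) \<Rightarrow> nat \<Rightarrow> 'k mpoly" where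
  "cmul c = smul (const c)"

text \<open>All free modules over \<open>S\<close> live in the single \<open>K\<close>-vector space of sequences of polynomials,
  with addition taken pointwise.\<close>

interpretation K: vector_space cmul
proof
  show "cmul 1 v = v" for v :: "nat \<Rightarrow> 'k::field mpoly"
    unfolding cmul_def smul_def const_def by simp
qed (simp_all add: cmul_def smul_def const_def fun_eq_iff algebra_simps single_add mult_single
    flip: mult.assoc)

lemma smul_apply: "smul p v b = p * v b" unfolding smul_def by simp

lemma sum_fun_apply: "(\<Sum>i\<in>A. f i) x = (\<Sum>i\<in>A. f i x)"
  by (induction A rule: infinite_finite_induct) simp_all

lemma finite_quotient_basis_eq: "finite_quotient_basis = K.quotient_basis"
proof (intro ext)
  fix Z B C :: "(nat \<Rightarrow> 'k::field mpoly) set"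
  have "(\<lambda>b. \<Sum>v\<in>C. const (a v) * v b) = (\<Sum>v\<in>C. cmul (a v) v)" for a
    by (simp add: fun_eq_iff sum_fun_apply cmul_def smul_def)
  moreover from this have
    "(\<lambda>b. z b - (\<Sum>v\<in>C. const (a v) * v b)) = z - (\<Sum>v\<in>C. cmul (a v) v)" for a z
    by (simp add: fun_eq_iff sum_fun_apply cmul_def smul_def)
  ultimately show "finite_quotient_basis Z B C = K.quotient_basis Z B C"
    unfolding finite_quotient_basis_def K.quotient_basis_def by simp
qed

lemma quotient_dim_plus_dim:
  assumes "K.finite_dim Z" "K.subspace B" "K.subspace Z" "B \<subseteq> Z"
  shows "quotient_dim Z B + K.dim B = K.dim Z"
proof -
  have card: "card C + K.dim B = K.dim Z" if "K.quotient_basis Z B C" for C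
    using K.quotient_basis_card[OF that assms] .
  obtain C where C: "K.quotient_basis Z B C" using K.quotient_basis_exists[OF assms] .
  have "quotient_dim Z B = card C"
    unfolding quotient_dim_def finite_quotient_basis_eq
  proof (rule the_equality)
    show "\<exists>D. K.quotient_basis Z B D \<and> card D = card C" using C by blast
    show "d = card C" if "\<exists>D. K.quotient_basis Z B D \<and> card D = d" for d
      using that card card[OF C] by fastforce
  qed
  then show ?thesis using card[OF C] by simp
qed

subsection \<open>The modules\<close>

lemma tensorD: "v \<in> tensor J P k \<Longrightarrow> b < rk P k \<Longrightarrow> v b \<in> J"
  unfolding tensor_def by blast

lemma tensor_outside: "v \<in> tensor J P k \<Longrightarrow> rk P k \<le> b \<Longrightarrow> v b = 0"
  unfolding tensor_def by blast

lemma tensor_mono: "J \<subseteq> L \<Longrightarrow> tensor J P k \<subseteq> tensor L P k"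
  unfolding tensor_def by blast

lemma tensor_Int: "tensor (X \<inter> Y) P k = tensor X P k \<inter> tensor Y P k"
  unfolding tensor_def by blast

lemma tensor_deg_Int: "tensor_deg (X \<inter> Y) P k t = tensor_deg X P k t \<inter> tensor_deg Y P k t"
  unfolding tensor_deg_def tensor_Int by blast

lemma tensor_deg_mono: "J \<subseteq> L \<Longrightarrow> tensor_deg J P k t \<subseteq> tensor_deg L P k t"
  unfolding tensor_deg_def using tensor_mono by blast

context
  fixes n :: nat and J :: "'k::field mpoly set"
  assumes J: "is_ideal n J"
begin

lemma tensor_zero: "0 \<in> tensor J P k"
  unfolding tensor_def by (simp add: ideal_zero[OF J])

lemma tensor_add: "v \<in> tensor J P k \<Longrightarrow> w \<in> tensor J P k \<Longrightarrow> v + w \<in> tensor J P k"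
  unfolding tensor_def by (simp add: ideal_add[OF J])

lemma tensor_uminus: "v \<in> tensor J P k \<Longrightarrow> - v \<in> tensor J P k"
  unfolding tensor_def by (simp add: ideal_uminus[OF J])

lemma tensor_minus: "v \<in> tensor J P k \<Longrightarrow> w \<in> tensor J P k \<Longrightarrow> v - w \<in> tensor J P k"
  unfolding tensor_def by (simp add: ideal_minus[OF J])

lemma tensor_smul: "p \<in> S n \<Longrightarrow> v \<in> tensor J P k \<Longrightarrow> smul p v \<in> tensor J P k"
  unfolding tensor_def by (simp add: ideal_mult[OF J] smul_def)

lemma subspace_tensor_deg: "K.subspace (tensor_deg J P k t)"
  unfolding K.subspace_def
proof (intro conjI ballI allI)
  show "0 \<in> tensor_deg J P k t"
    unfolding tensor_deg_def by (simp add: tensor_zero homogeneous_zero)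
  show "v + w \<in> tensor_deg J P k t" if "v \<in> tensor_deg J P k t" "w \<in> tensor_deg J P k t" for v w
    using that unfolding tensor_deg_def by (simp add: tensor_add homogeneous_add)
  show "cmul c v \<in> tensor_deg J P k t" if "v \<in> tensor_deg J P k t" for c v
  proof -
    have "homogeneous (0 + d) (const c * p)" if "homogeneous d p" for d p
      using that homogeneous_monomial[of 0 c] unfolding const_def
      by (intro homogeneous_mult) (simp_all add: mon_deg_def)
    then show ?thesis
      using that unfolding tensor_deg_def cmul_def
      by (simp add: tensor_smul const_in_S smul_apply)
  qed
qed

end

lemma finite_monomials:
  "finite {m :: nat \<Rightarrow>\<^sub>0 nat. Poly_Mapping.keys m \<subseteq> {1..n} \<and> int (mon_deg m) = d}" (is "finite ?M")
proof -
  let ?F = "{f. \<forall>i. (i \<in> {1..n} \<longrightarrow> f i \<in> {..nat d}) \<and> (i \<notin> {1..n} \<longrightarrow> f i = (0::nat))}"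
  have "Poly_Mapping.lookup m \<in> ?F" if m: "m \<in> ?M" for m
  proof -
    have "Poly_Mapping.lookup m i \<le> nat d" for i
    proof (cases "i \<in> Poly_Mapping.keys m")
      case True
      then have "Poly_Mapping.lookup m i \<le> mon_deg m"
        unfolding mon_deg_def by (intro member_le_sum) auto
      then show ?thesis using m by auto
    qed (simp add: in_keys_iff)
    moreover have "Poly_Mapping.lookup m i = 0" if "i \<notin> {1..n}" for i
      using m that by (auto simp: in_keys_iff subset_iff)
    ultimately show ?thesis by simp
  qed
  moreover have "finite ?F" by (rule finite_set_of_finite_funs) simp_all
  ultimately have "finite (Poly_Mapping.lookup ` ?M)"
    by (meson finite_subset image_subsetI)
  then show ?thesis
    by (rule finite_imageD) (rule inj_onI, metis poly_mapping_eqI)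
qed

text \<open>There are finitely many basis elements and finitely many monomials of each degree; their
  products span.\<close>

lemma finite_dim_tensor_deg: "K.finite_dim (tensor_deg (S n :: 'k::field mpoly set) P k t)"
proof -
  define e where "e b m = (\<lambda>c. if c = b then Poly_Mapping.single m (1 :: 'k) else 0)" for b :: nat and m :: "nat \<Rightarrow>\<^sub>0 nat"
  define F where "F = (\<Union>b<rk P k. e b ` {m. Poly_Mapping.keys m \<subseteq> {1..n} \<and> int (mon_deg m) = t - gdeg P k b})"
  have "finite F" unfolding F_def using finite_monomials by auto
  moreover have "v \<in> K.span F" if v: "v \<in> tensor_deg (S n) P k t" for v
  proof -
    have "v = (\<Sum>b<rk P k. \<Sum>m\<in>Poly_Mapping.keys (v b). cmul (Poly_Mapping.lookup (v b) m) (e b m))"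
    proof
      fix c
      have mon: "const a * Poly_Mapping.single m 1 = Poly_Mapping.single m a" for a :: 'k and m
        unfolding const_def by (simp add: mult_single)
      have "(\<Sum>b<rk P k. \<Sum>m\<in>Poly_Mapping.keys (v b). cmul (Poly_Mapping.lookup (v b) m) (e b m)) c
        = (\<Sum>b<rk P k. if c = b then (\<Sum>m\<in>Poly_Mapping.keys (v b).
              Poly_Mapping.single m (Poly_Mapping.lookup (v b) m)) else 0)"
        unfolding sum_fun_apply cmul_def smul_def e_def
        by (intro sum.cong) (simp_all add: mon)
      also have "\<dots> = (if c < rk P k then (\<Sum>m\<in>Poly_Mapping.keys (v c).
              Poly_Mapping.single m (Poly_Mapping.lookup (v c) m)) else 0)"
        by simp
      also have "\<dots> = v c"
      proof (cases "c < rk P k")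
        case True
        have "(\<Sum>m\<in>Poly_Mapping.keys (v c). Poly_Mapping.single m (Poly_Mapping.lookup (v c) m)) = v c"
          by (intro poly_mapping_eqI) (simp add: lookup_sum lookup_single when_def in_keys_iff)
        then show ?thesis using True by simp
      next
        case False
        then show ?thesis using v tensor_outside unfolding tensor_deg_def by fastforce
      qed
      finally show "v c = (\<Sum>b<rk P k. \<Sum>m\<in>Poly_Mapping.keys (v b).
        cmul (Poly_Mapping.lookup (v b) m) (e b m)) c" by simp
    qed
    also have "\<dots> \<in> K.span F"
    proof (intro K.span_sum K.span_scale K.span_base)
      fix b m assume b: "b \<in> {..<rk P k}" and m: "m \<in> Poly_Mapping.keys (v b)"
      have "v b \<in> S n" "homogeneous (t - gdeg P k b) (v b)"
        using v b tensorD unfolding tensor_deg_def by auto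
      then have "m \<in> {m. Poly_Mapping.keys m \<subseteq> {1..n} \<and> int (mon_deg m) = t - gdeg P k b}"
        using m unfolding S_def homogeneous_def by blast
      then show "e b m \<in> F" using b unfolding F_def by blast
    qed
    finally show ?thesis .
  qed
  ultimately show ?thesis unfolding K.finite_dim_def by blast
qed

subsection \<open>The differentials\<close>

lemma diff_add: "diff P k (v + w) = diff P k v + diff P k w"
  unfolding diff_def by (auto simp: fun_eq_iff distrib_right sum.distrib)

lemma diff_smul: "diff P k (smul p v) = smul p (diff P k v)"
  unfolding diff_def smul_def by (auto simp: fun_eq_iff sum_distrib_left mult.assoc)

lemma diff_zero: "diff P k 0 = 0"
  unfolding diff_def by (simp add: fun_eq_iff)

lemma diff_uminus: "diff P k (- v) = - diff P k v"
  unfolding diff_def by (simp add: fun_eq_iff sum_negf)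

lemma diff_minus: "diff P k (v - w) = diff P k v - diff P k w"
  unfolding diff_def by (simp add: fun_eq_iff left_diff_distrib sum_subtractf)

lemma linear_diff: "Vector_Spaces.linear cmul cmul (diff P k)"
  by unfold_locales (simp_all add: diff_add diff_smul cmul_def)

lemma linear_smul: "Vector_Spaces.linear cmul cmul (smul p)"
  by unfold_locales (simp_all add: cmul_def smul_def fun_eq_iff algebra_simps)

definition unit_vec :: "nat \<Rightarrow> nat \<Rightarrow> 'k::field mpoly" where
  "unit_vec b = (\<lambda>c. if c = b then 1 else 0)"

lemma unit_vec_in_tensor: "b < rk P k \<Longrightarrow> unit_vec b \<in> tensor (S n) P k"
  unfolding tensor_def unit_vec_def by (simp add: zero_in_S one_in_S)

lemma sum_unit_vec: "v \<in> tensor J P k \<Longrightarrow> (\<Sum>b<rk P k. v b * unit_vec b c) = v c"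
  unfolding unit_vec_def using tensor_outside[of v J P k c] 
  by (cases "c < rk P k") (simp_all add: if_distrib[of "\<lambda>x. _ * x"] cong: if_cong)

lemma diff_unit_vec: "b < rk P (Suc k) \<Longrightarrow> c < rk P k \<Longrightarrow> diff P k (unit_vec b) c = dmat P k b c"
  unfolding diff_def unit_vec_def by (simp add: if_distrib[of "\<lambda>x. x * _"] cong: if_cong)

text \<open>The \<open>S\<close>-linear map on \<open>P_k\<close> that sends the \<open>b\<close>-th basis element to \<open>H b\<close>.\<close>

definition linear_ext :: "'k::field free_complex \<Rightarrow> nat \<Rightarrow> (nat \<Rightarrow> nat \<Rightarrow> 'k mpoly) \<Rightarrow> (nat \<Rightarrow> 'k mpoly)
    \<Rightarrow> nat \<Rightarrow> 'k mpoly" where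
  "linear_ext P k H v = (\<lambda>c. \<Sum>b<rk P k. v b * H b c)"

lemma linear_ext_in_tensor:
  assumes "is_ideal n J" "\<And>b. b < rk P k \<Longrightarrow> H b \<in> tensor (S n) P l" "v \<in> tensor J P k"
  shows "linear_ext P k H v \<in> tensor J P l"
  unfolding tensor_def linear_ext_def
  using assms(2)[THEN tensorD] assms(2)[THEN tensor_outside] tensorD[OF assms(3)]
  by (auto intro!: ideal_sum[OF assms(1)] ideal_mult_right[OF assms(1)])

lemma diff_linear_ext: "diff P l (linear_ext P k H v) = (\<lambda>c. \<Sum>b<rk P k. v b * diff P l (H b) c)"
proof
  fix c
  show "diff P l (linear_ext P k H v) c = (\<Sum>b<rk P k. v b * diff P l (H b) c)"
  proof (cases "c < rk P l")
    case True
    then have "diff P l (linear_ext P k H v) c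
      = (\<Sum>b'<rk P (Suc l). \<Sum>b<rk P k. v b * H b b' * dmat P l b' c)"
      unfolding diff_def linear_ext_def by (simp add: sum_distrib_right)
    also have "\<dots> = (\<Sum>b<rk P k. \<Sum>b'<rk P (Suc l). v b * H b b' * dmat P l b' c)"
      by (rule sum.swap)
    finally show ?thesis using True unfolding diff_def by (simp add: sum_distrib_left mult.assoc)
  qed (simp add: diff_def)
qed

lemma linear_ext_diff: "linear_ext P k H (diff P k v) = (\<lambda>c. \<Sum>b<rk P (Suc k). v b * linear_ext P k H (diff P k (unit_vec b)) c)"
proof
  fix c
  have "linear_ext P k H (diff P k v) c
    = (\<Sum>b'<rk P k. \<Sum>b<rk P (Suc k). v b * dmat P k b b' * H b' c)"
    unfolding linear_ext_def diff_def by (simp add: sum_distrib_right)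
  also have "\<dots> = (\<Sum>b<rk P (Suc k). \<Sum>b'<rk P k. v b * dmat P k b b' * H b' c)"
    by (rule sum.swap)
  also have "\<dots> = (\<Sum>b<rk P (Suc k). v b * linear_ext P k H (diff P k (unit_vec b)) c)"
    unfolding linear_ext_def by (intro sum.cong) (simp_all add: sum_distrib_left diff_unit_vec mult.assoc)
  finally show "linear_ext P k H (diff P k v) c
    = (\<Sum>b<rk P (Suc k). v b * linear_ext P k H (diff P k (unit_vec b)) c)" .
qed

definition homogeneous_ideal :: "nat \<Rightarrow> 'k::field mpoly set \<Rightarrow> bool" where
  "homogeneous_ideal n J \<longleftrightarrow> is_ideal n J \<and> (\<forall>p\<in>J. \<forall>d. hcomp d p \<in> J)"

definition tensor_comp :: "'k::field free_complex \<Rightarrow> nat \<Rightarrow> int \<Rightarrow> (nat \<Rightarrow> 'k mpoly) \<Rightarrow> nat \<Rightarrow> 'k mpoly" where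
  "tensor_comp P k t v = (\<lambda>b. hcomp (t - gdeg P k b) (v b))"

lemma tensor_comp_in_tensor_deg:
  assumes "homogeneous_ideal n J" "v \<in> tensor J P k"
  shows "tensor_comp P k t v \<in> tensor_deg J P k t"
  using assms unfolding tensor_deg_def tensor_def tensor_comp_def homogeneous_ideal_def
  by (simp add: homogeneous_hcomp) (simp add: hcomp_def part_zero)

lemma tensor_comp_tensor_deg: "v \<in> tensor_deg J P k t \<Longrightarrow> tensor_comp P k t v = v"
  unfolding tensor_deg_def tensor_def tensor_comp_def
  by (rule ext, case_tac "b < rk P k") (simp_all add: hcomp_homogeneous, simp add: hcomp_def part_zero)

context
  fixes n :: nat and P :: "'k::field free_complex"
  assumes R: "graded_free_resolution n P"
begin

lemma dmat_in_S: "b < rk P (Suc k) \<Longrightarrow> c < rk P k \<Longrightarrow> dmat P k b c \<in> S n"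
  and dmat_homogeneous: "b < rk P (Suc k) \<Longrightarrow> c < rk P k \<Longrightarrow>
      homogeneous (gdeg P (Suc k) b - gdeg P k c) (dmat P k b c)"
  and augment_exact: "{v \<in> tensor (S n) P 0. augment P v = 0} = diff P 0 ` tensor (S n) P 1"
  and diff_exact: "{v \<in> tensor (S n) P (Suc k). diff P k v = 0} = diff P (Suc k) ` tensor (S n) P (Suc (Suc k))"
proof -
  note R' = R[unfolded graded_free_resolution_def, folded zero_fun_def]
  show "dmat P k b c \<in> S n" "homogeneous (gdeg P (Suc k) b - gdeg P k c) (dmat P k b c)"
    if "b < rk P (Suc k)" "c < rk P k"
    using R'[THEN conjunct1] that by simp_all
  show "{v \<in> tensor (S n) P 0. augment P v = 0} = diff P 0 ` tensor (S n) P 1"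
    using R'[THEN conjunct2, THEN conjunct2, THEN conjunct2, THEN conjunct1] .
  show "{v \<in> tensor (S n) P (Suc k). diff P k v = 0} = diff P (Suc k) ` tensor (S n) P (Suc (Suc k))"
    using R'[THEN conjunct2, THEN conjunct2, THEN conjunct2, THEN conjunct2] by simp
qed

lemma diff_in_tensor:
  assumes J: "is_ideal n J" and v: "v \<in> tensor J P (Suc k)"
  shows "diff P k v \<in> tensor J P k"
  unfolding tensor_def diff_def using tensorD[OF v]
  by (auto intro!: ideal_sum[OF J] ideal_mult_right[OF J] dmat_in_S)

lemma diff_in_tensor_deg:
  assumes J: "is_ideal n J" and v: "v \<in> tensor_deg J P (Suc k) t"
  shows "diff P k v \<in> tensor_deg J P k t"
proof -
  have "homogeneous (t - gdeg P k c) (diff P k v c)" if c: "c < rk P k" for c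
  proof -
    have "homogeneous (t - gdeg P k c) (v b * dmat P k b c)" if b: "b < rk P (Suc k)" for b
      using homogeneous_mult[OF _ dmat_homogeneous[OF b c], of "t - gdeg P (Suc k) b" "v b"] v b
      unfolding tensor_deg_def by simp
    then show ?thesis using c unfolding diff_def by (auto intro!: homogeneous_sum)
  qed
  then show ?thesis using v diff_in_tensor[OF J] unfolding tensor_deg_def by blast
qed

lemma diff_diff: "v \<in> tensor (S n) P (Suc (Suc k)) \<Longrightarrow> diff P k (diff P (Suc k) v) = 0"
  using diff_exact by blast

lemma diff_tensor_comp:
  "diff P k (tensor_comp P (Suc k) t v) = tensor_comp P k t (diff P k v)"
proof
  fix c
  show "diff P k (tensor_comp P (Suc k) t v) c = tensor_comp P k t (diff P k v) c"
  proof (cases "c < rk P k")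
    case True
    have "hcomp (t - gdeg P k c) (v b * dmat P k b c) = hcomp (t - gdeg P (Suc k) b) (v b) * dmat P k b c"
      if b: "b < rk P (Suc k)" for b
      using hcomp_mult_homogeneous[OF dmat_homogeneous[OF b True]] by simp
    then show ?thesis
      using True unfolding diff_def tensor_comp_def by (simp add: hcomp_def part_sum)
  qed (simp add: diff_def tensor_comp_def hcomp_def part_zero)
qed

text \<open>Since the differentials respect degrees, a homogeneous boundary is already the boundary of
  a homogeneous component of any of its preimages. The exactness of a resolution, which is stated without degrees,
  can therefore be used degree by degree, and homotopies need not be homogeneous.\<close>

lemma homogeneous_boundary:
  assumes J: "homogeneous_ideal n J" and v: "v \<in> tensor J P (Suc k)"
    and z: "diff P k v \<in> tensor_deg (S n) P k t"
  shows "diff P k v \<in> boundaries P J k t"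
proof -
  have "diff P k v = diff P k (tensor_comp P (Suc k) t v)"
    unfolding diff_tensor_comp using tensor_comp_tensor_deg[OF z] by simp
  then show ?thesis
    unfolding boundaries_def using tensor_comp_in_tensor_deg[OF J v] by blast
qed

text \<open>A polynomial \<open>x\<close> without constant term acts as zero on \<open>K\<close>, so multiplication by \<open>x\<close> on a
  resolution of \<open>K\<close> is null-homotopic: \<open>d H + H d = x\<close>. On cycles the second term vanishes, and this
  weaker identity is all that the induction needs. If \<open>H\<close> satisfies it on \<open>P_k\<close>, then
  \<open>x e - H (d e)\<close> is a cycle for each basis element \<open>e\<close> of \<open>P_(k+1)\<close>, because \<open>d e\<close> is a cycle; a
  preimage of it under \<open>d\<close> is the value of the next homotopy at \<open>e\<close>.\<close>

lemma null_homotopy_on_cycles: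
  assumes x: "x \<in> S n" "Poly_Mapping.lookup x 0 = 0"
  shows "\<exists>H. (\<forall>b<rk P k. H b \<in> tensor (S n) P (Suc k)) \<and>
     (\<forall>v\<in>tensor (S n) P k. k = 0 \<or> diff P (k - 1) v = 0 \<longrightarrow> diff P k (linear_ext P k H v) = smul x v)"
proof (induction k)
  case 0
  have "\<exists>y\<in>tensor (S n) P 1. diff P 0 y = smul x (unit_vec b)" if b: "b < rk P 0" for b
  proof -
    have "Poly_Mapping.lookup (smul x (unit_vec b) c) 0 = 0" for c
      using x(2) unfolding smul_def unit_vec_def by simp
    then have "augment P (smul x (unit_vec b)) = 0" unfolding augment_def by simp
    moreover have "smul x (unit_vec b) \<in> tensor (S n) P 0"
      using tensor_smul[OF is_ideal_S x(1) unit_vec_in_tensor[OF b]] .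
    ultimately have "smul x (unit_vec b) \<in> diff P 0 ` tensor (S n) P 1"
      using augment_exact by blast
    then show ?thesis by (metis imageE)
  qed
  then obtain H where H: "\<And>b. b < rk P 0 \<Longrightarrow> H b \<in> tensor (S n) P 1 \<and> diff P 0 (H b) = smul x (unit_vec b)"
    by metis
  have "diff P 0 (linear_ext P 0 H v) = smul x v" if v: "v \<in> tensor (S n) P 0" for v
  proof
    fix c
    have "diff P 0 (linear_ext P 0 H v) c = (\<Sum>b<rk P 0. x * (v b * unit_vec b c))"
      unfolding diff_linear_ext using H by (intro sum.cong) (auto simp: smul_def mult_ac)
    then show "diff P 0 (linear_ext P 0 H v) c = smul x v c"
      using sum_unit_vec[OF v] by (simp add: smul_def flip: sum_distrib_left)
  qed
  then show ?case using H by auto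
next
  case (Suc k)
  then obtain H where H: "\<And>b. b < rk P k \<Longrightarrow> H b \<in> tensor (S n) P (Suc k)"
    and null: "\<And>v. v \<in> tensor (S n) P k \<Longrightarrow> k = 0 \<or> diff P (k - 1) v = 0 \<Longrightarrow>
      diff P k (linear_ext P k H v) = smul x v"
    by blast
  define y where "y b = smul x (unit_vec b) - linear_ext P k H (diff P k (unit_vec b))" for b
  have "\<exists>w\<in>tensor (S n) P (Suc (Suc k)). diff P (Suc k) w = y b" if b: "b < rk P (Suc k)" for b
  proof -
    let ?e = "unit_vec b :: nat \<Rightarrow> 'k mpoly"
    have e: "?e \<in> tensor (S n) P (Suc k)" using unit_vec_in_tensor[OF b] .
    then have de: "diff P k ?e \<in> tensor (S n) P k" using diff_in_tensor[OF is_ideal_S] by blast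
    have "y b \<in> tensor (S n) P (Suc k)"
      unfolding y_def
      by (intro tensor_minus[OF is_ideal_S] tensor_smul[OF is_ideal_S] x e
          linear_ext_in_tensor[OF is_ideal_S _ de] H)
    moreover have "k = 0 \<or> diff P (k - 1) (diff P k ?e) = 0"
      using diff_diff[of ?e "k - 1"] e by (cases k) auto
    then have "diff P k (y b) = 0"
      unfolding y_def diff_minus diff_smul using null[OF de] by simp
    ultimately have "y b \<in> diff P (Suc k) ` tensor (S n) P (Suc (Suc k))"
      using diff_exact by blast
    then show ?thesis by (metis imageE)
  qed
  then obtain H' where H': "\<And>b. b < rk P (Suc k) \<Longrightarrow>
      H' b \<in> tensor (S n) P (Suc (Suc k)) \<and> diff P (Suc k) (H' b) = y b"
    by metis
  have "diff P (Suc k) (linear_ext P (Suc k) H' v) = smul x v"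
    if v: "v \<in> tensor (S n) P (Suc k)" and dv: "diff P k v = 0" for v
  proof
    fix c
    have "diff P (Suc k) (linear_ext P (Suc k) H' v) c = (\<Sum>b<rk P (Suc k). v b * y b c)"
      unfolding diff_linear_ext using H' by (intro sum.cong) auto
    also have "\<dots> = (\<Sum>b<rk P (Suc k). x * (v b * unit_vec b c))
        - (\<Sum>b<rk P (Suc k). v b * linear_ext P k H (diff P k (unit_vec b)) c)"
      unfolding y_def smul_def by (simp add: algebra_simps sum_subtractf)
    also have "(\<Sum>b<rk P (Suc k). v b * linear_ext P k H (diff P k (unit_vec b)) c)
        = linear_ext P k H (diff P k v) c"
      by (rule fun_cong[OF linear_ext_diff, symmetric])
    also have "\<dots> = 0" unfolding dv linear_ext_def by simp
    finally show "diff P (Suc k) (linear_ext P (Suc k) H' v) c = smul x v c"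
      using sum_unit_vec[OF v] by (simp add: smul_def flip: sum_distrib_left)
  qed
  then show ?case using H' by (metis diff_Suc_1 nat.simps(3))
qed

text \<open>The homotopy is \<open>S\<close>-linear and so preserves coefficients in \<open>J\<close>. Hence multiplication by \<open>x\<close>
  is zero on \<open>Tor(J, K)\<close>.\<close>

lemma multiple_of_cycle_is_boundary:
  assumes x: "x \<in> S n" "Poly_Mapping.lookup x 0 = 0" and J: "homogeneous_ideal n J"
    and w: "w \<in> tensor J P k" and cyc: "k = 0 \<or> diff P (k - 1) w = 0"
    and deg: "smul x w \<in> tensor_deg (S n) P k t"
  shows "smul x w \<in> boundaries P J k t"
proof -
  obtain H where H: "\<And>b. b < rk P k \<Longrightarrow> H b \<in> tensor (S n) P (Suc k)"
    and null: "\<And>v. v \<in> tensor (S n) P k \<Longrightarrow> k = 0 \<or> diff P (k - 1) v = 0 \<Longrightarrow>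
      diff P k (linear_ext P k H v) = smul x v"
    using null_homotopy_on_cycles[OF x, of k] by auto
  have J': "is_ideal n J" using J unfolding homogeneous_ideal_def by blast
  have "w \<in> tensor (S n) P k" using w tensor_mono[OF ideal_subset[OF J']] by blast
  then have eq: "smul x w = diff P k (linear_ext P k H w)" using null cyc by simp
  have "linear_ext P k H w \<in> tensor J P (Suc k)" by (rule linear_ext_in_tensor[OF J' H w])
  then show ?thesis using homogeneous_boundary[OF J] deg unfolding eq by blast
qed

end

section \<open>Betti splittings\<close>

text \<open>The Betti number as read off from a given resolution \<open>P\<close>.\<close>

definition tor_dim :: "'k::field free_complex \<Rightarrow> 'k mpoly set \<Rightarrow> nat \<Rightarrow> int \<Rightarrow> nat" where
  "tor_dim P J i t = quotient_dim (cycles P J i t) (boundaries P J i t)"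

lemma cycles_Suc: "cycles P J (Suc k) t = {v \<in> tensor_deg J P (Suc k) t. diff P k v = 0}"
  unfolding cycles_def zero_fun_def by simp

lemma cycles_subset: "cycles P J k t \<subseteq> tensor_deg J P k t"
  unfolding cycles_def by blast

lemma cycles_Int: "cycles P (X \<inter> Y) k t = cycles P X k t \<inter> cycles P Y k t"
  unfolding cycles_def tensor_deg_Int by blast

lemma tensor_image_mult: "tensor ((*) u ` J) P k = smul u ` tensor J P k"
proof (intro equalityI subsetI)
  fix z assume z: "z \<in> tensor ((*) u ` J) P k"
  then have "\<exists>y\<in>J. z b = u * y" if "b < rk P k" for b
    using that unfolding tensor_def by auto
  then obtain y where y: "\<And>b. b < rk P k \<Longrightarrow> y b \<in> J \<and> z b = u * y b" by metis
  define v where "v = (\<lambda>b. if b < rk P k then y b else 0)"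
  have "v \<in> tensor J P k" "z = smul u v"
    using y z unfolding v_def smul_def tensor_def by (auto simp: fun_eq_iff)
  then show "z \<in> smul u ` tensor J P k" by blast
qed (auto simp: tensor_def smul_def)

context
  fixes n :: nat and P :: "'k::field free_complex"
  assumes R: "graded_free_resolution n P"
begin

lemma finite_dim_tensor_deg_ideal:
  "is_ideal n (J :: 'k mpoly set) \<Longrightarrow> K.finite_dim (tensor_deg J P k t)"
  using K.finite_dim_subset[OF finite_dim_tensor_deg tensor_deg_mono[OF ideal_subset]] .

lemma subspace_cycles:
  assumes J: "is_ideal n J"
  shows "K.subspace (cycles P J k t)"
proof (cases k)
  case 0
  then show ?thesis unfolding cycles_def using subspace_tensor_deg[OF J] by simp
next
  case (Suc l)
  interpret d: Vector_Spaces.linear cmul cmul "diff P l" by (rule linear_diff)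
  show ?thesis
    unfolding Suc cycles_Suc using subspace_tensor_deg[OF J, of P "Suc l" t]
    unfolding K.subspace_def by (simp add: d.add d.scale d.zero)
qed

lemma subspace_boundaries:
  assumes J: "is_ideal n J"
  shows "K.subspace (boundaries P J k t)"
proof -
  interpret d: Vector_Spaces.linear cmul cmul "diff P k" by (rule linear_diff)
  show ?thesis unfolding boundaries_def using d.subspace_image[OF subspace_tensor_deg[OF J]] .
qed

lemma boundaries_subset_cycles:
  assumes J: "is_ideal n J"
  shows "boundaries P J k t \<subseteq> cycles P J k t"
proof
  fix z assume "z \<in> boundaries P J k t"
  then obtain v where v: "v \<in> tensor_deg J P (Suc k) t" and z: "z = diff P k v"
    unfolding boundaries_def by blast
  have z_deg: "z \<in> tensor_deg J P k t" unfolding z by (rule diff_in_tensor_deg[OF R J v])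
  show "z \<in> cycles P J k t"
  proof (cases k)
    case 0
    then show ?thesis using z_deg unfolding cycles_def by simp
  next
    case (Suc l)
    have "v \<in> tensor (S n) P (Suc (Suc l))"
      using v tensor_mono[OF ideal_subset[OF J]] unfolding tensor_deg_def Suc by blast
    then have "diff P l z = 0" unfolding z Suc by (rule diff_diff[OF R])
    then show ?thesis using z_deg unfolding Suc cycles_Suc by blast
  qed
qed

lemma tor_dim_plus_dim_boundaries:
  assumes J: "is_ideal n J"
  shows "tor_dim P J k t + K.dim (boundaries P J k t) = K.dim (cycles P J k t)"
  unfolding tor_dim_def
  using quotient_dim_plus_dim K.finite_dim_subset[OF finite_dim_tensor_deg_ideal[OF J] cycles_subset]
    subspace_boundaries[OF J] subspace_cycles[OF J] boundaries_subset_cycles[OF J]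
  by blast

lemma dim_cycles_plus_dim_boundaries:
  assumes J: "is_ideal n J"
  shows "K.dim (cycles P J (Suc k) t) + K.dim (boundaries P J k t) = K.dim (tensor_deg J P (Suc k) t)"
  unfolding cycles_Suc boundaries_def
  using K.dim_kernel_plus_dim_image[OF linear_diff finite_dim_tensor_deg_ideal[OF J] subspace_tensor_deg[OF J]] .

text \<open>Write \<open>Z\<close> and \<open>B\<close> for cycles and boundaries. The tensored modules and the boundaries of
  \<open>X + Y\<close> are the sums of those of \<open>X\<close> and \<open>Y\<close>, and the modules of \<open>X \<inter> Y\<close> are the intersections.
  The vanishing of the two maps on Tor says precisely that the intersection of \<open>B(X)\<close> and \<open>B(Y)\<close> is
  \<open>Z(X \<inter> Y)\<close>. So the dimensions of the modules and of the boundaries of \<open>X + Y\<close> are known in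
  positions \<open>i\<close> and \<open>i + 1\<close>, and rank-nullity gives those of the cycles.\<close>

lemma betti_splitting:
  assumes X: "homogeneous_ideal n X" and Y: "homogeneous_ideal n Y" and W: "homogeneous_ideal n W"
    and sum: "W = {x + y | x y. x \<in> X \<and> y \<in> Y}"
    and zero: "\<And>k. k = i \<or> k = Suc i \<Longrightarrow>
      cycles P (X \<inter> Y) k t \<subseteq> boundaries P X k t \<inter> boundaries P Y k t"
  shows "tor_dim P W (Suc i) t = tor_dim P X (Suc i) t + tor_dim P Y (Suc i) t + tor_dim P (X \<inter> Y) i t"
proof -
  have X': "is_ideal n X" and Y': "is_ideal n Y" and W': "is_ideal n W"
    using X Y W unfolding homogeneous_ideal_def by blast+
  have XY': "is_ideal n (X \<inter> Y)" using X' Y' unfolding is_ideal_def by blast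
  have XW: "X \<subseteq> W" unfolding sum using ideal_zero[OF Y'] by force
  have YW: "Y \<subseteq> W" unfolding sum using ideal_zero[OF X'] by force
  have deg_sum: "tensor_deg W P k t = {x + y | x y. x \<in> tensor_deg X P k t \<and> y \<in> tensor_deg Y P k t}" for k
  proof (intro equalityI subsetI)
    fix v assume v: "v \<in> tensor_deg W P k t"
    then have "\<exists>x y. v b = x + y \<and> x \<in> X \<and> y \<in> Y" if "b < rk P k" for b
      using that unfolding tensor_deg_def tensor_def sum by auto
    then obtain x y where xy: "\<And>b. b < rk P k \<Longrightarrow> v b = x b + y b \<and> x b \<in> X \<and> y b \<in> Y"
      by metis
    \<comment> \<open>The summands of a homogeneous vector need not be homogeneous, but their components are.\<close>
    define x' where "x' = (\<lambda>b. if b < rk P k then x b else 0)"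
    define y' where "y' = (\<lambda>b. if b < rk P k then y b else 0)"
    have x': "x' \<in> tensor X P k" and y': "y' \<in> tensor Y P k"
      using xy unfolding tensor_def x'_def y'_def by auto
    have "v b = x' b + y' b" for b
      using xy[of b] v unfolding tensor_deg_def tensor_def x'_def y'_def by auto
    then have "v = x' + y'" by (simp add: fun_eq_iff)
    then have "tensor_comp P k t v = tensor_comp P k t x' + tensor_comp P k t y'"
      unfolding tensor_comp_def by (simp add: fun_eq_iff hcomp_def part_add)
    then show "v \<in> {x + y | x y. x \<in> tensor_deg X P k t \<and> y \<in> tensor_deg Y P k t}"
      using tensor_comp_tensor_deg[OF v] tensor_comp_in_tensor_deg[OF X x']
        tensor_comp_in_tensor_deg[OF Y y'] by force
  next
    fix v assume "v \<in> {x + y | x y. x \<in> tensor_deg X P k t \<and> y \<in> tensor_deg Y P k t}"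
    then obtain x y where "v = x + y" "x \<in> tensor_deg W P k t" "y \<in> tensor_deg W P k t"
      using tensor_deg_mono[OF XW] tensor_deg_mono[OF YW] by blast
    then show "v \<in> tensor_deg W P k t"
      using K.subspace_add[OF subspace_tensor_deg[OF W']] by blast
  qed
  have bd_sum: "boundaries P W k t = {x + y | x y. x \<in> boundaries P X k t \<and> y \<in> boundaries P Y k t}" for k
  proof -
    have "boundaries P W k t
        = {diff P k (x + y) | x y. x \<in> tensor_deg X P (Suc k) t \<and> y \<in> tensor_deg Y P (Suc k) t}"
      unfolding boundaries_def deg_sum by blast
    also have "\<dots> = {x + y | x y. x \<in> boundaries P X k t \<and> y \<in> boundaries P Y k t}"
      unfolding boundaries_def diff_add by blast
    finally show ?thesis .
  qed
  have bd_Int: "boundaries P X k t \<inter> boundaries P Y k t = cycles P (X \<inter> Y) k t"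
    if "k = i \<or> k = Suc i" for k
    using zero[OF that] boundaries_subset_cycles[OF X'] boundaries_subset_cycles[OF Y']
    unfolding cycles_Int by blast
  have dim_deg: "K.dim (tensor_deg W P k t) + K.dim (tensor_deg (X \<inter> Y) P k t)
      = K.dim (tensor_deg X P k t) + K.dim (tensor_deg Y P k t)" for k
    using K.dim_sum_plus_dim_Int[OF subspace_tensor_deg[OF X', of P k t] subspace_tensor_deg[OF Y', of P k t]]
      finite_dim_tensor_deg_ideal[OF W', of k t] unfolding deg_sum tensor_deg_Int by blast
  have dim_bd: "K.dim (boundaries P W k t) + K.dim (cycles P (X \<inter> Y) k t)
      = K.dim (boundaries P X k t) + K.dim (boundaries P Y k t)" if "k = i \<or> k = Suc i" for k
    using K.dim_sum_plus_dim_Int[OF subspace_boundaries[OF X', of k t] subspace_boundaries[OF Y', of k t]]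
      K.finite_dim_linear_image[OF finite_dim_tensor_deg_ideal[OF W'] linear_diff]
    unfolding bd_Int[OF that] bd_sum[symmetric] boundaries_def[of P W] by blast
  show ?thesis
    using dim_deg[of "Suc i"] dim_bd[of i] dim_bd[of "Suc i"]
      tor_dim_plus_dim_boundaries[OF X', of "Suc i" t] dim_cycles_plus_dim_boundaries[OF X', of i t]
      tor_dim_plus_dim_boundaries[OF Y', of "Suc i" t] dim_cycles_plus_dim_boundaries[OF Y', of i t]
      tor_dim_plus_dim_boundaries[OF W', of "Suc i" t] dim_cycles_plus_dim_boundaries[OF W', of i t]
      tor_dim_plus_dim_boundaries[OF XY', of i t] dim_cycles_plus_dim_boundaries[OF XY', of i t]
    by simp
qed

lemma tor_dim_shift:
  assumes J: "is_ideal n J" and A: "is_ideal n A"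
    and AJ: "A = (*) (Poly_Mapping.single m 1) ` J"
  shows "tor_dim P A k t = tor_dim P J k (t - int (mon_deg m))"
proof -
  define u where "u = (Poly_Mapping.single m 1 :: 'k mpoly)"
  have u0: "u \<noteq> 0" unfolding u_def by (metis single_zero inj_single injD zero_neq_one)
  have smul0: "smul u v = 0 \<longleftrightarrow> v = 0" for v
    using u0 by (simp add: smul_def fun_eq_iff)
  have deg: "smul u ` tensor_deg J P l (t - int (mon_deg m)) = tensor_deg A P l t" for l
    unfolding tensor_deg_def AJ u_def[symmetric] tensor_image_mult
    by (auto simp: u_def smul_apply homogeneous_monomial_mult_iff diff_diff_eq add.commute)
  have cyc: "smul u ` cycles P J k (t - int (mon_deg m)) = cycles P A k t"
    unfolding cycles_def deg[symmetric] zero_fun_def[symmetric] by (auto simp: diff_smul smul0)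
  have bd: "smul u ` boundaries P J k (t - int (mon_deg m)) = boundaries P A k t"
    unfolding boundaries_def deg[symmetric] image_image diff_smul ..
  have fd: "K.finite_dim (cycles P J k (t - int (mon_deg m)))"
    using K.finite_dim_subset[OF finite_dim_tensor_deg_ideal[OF J] cycles_subset] .
  have "K.dim (cycles P A k t) = K.dim (cycles P J k (t - int (mon_deg m)))"
    unfolding cyc[symmetric]
    using K.dim_injective_image[OF linear_smul fd subspace_cycles[OF J]] smul0 by blast
  moreover have "K.dim (boundaries P A k t) = K.dim (boundaries P J k (t - int (mon_deg m)))"
    unfolding bd[symmetric]
    using K.dim_injective_image[OF linear_smul K.finite_dim_subset[OF fd boundaries_subset_cycles[OF J]]
      subspace_boundaries[OF J]] smul0 by blast
  ultimately show ?thesis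
    using tor_dim_plus_dim_boundaries[OF J, of k "t - int (mon_deg m)"]
      tor_dim_plus_dim_boundaries[OF A, of k t] by simp
qed

end

section \<open>The Koszul complex\<close>

text \<open>\<open>P\<close> is a resolution of \<open>S/(x_1, ..., x_k)\<close> by graded free modules, with \<open>P_0 = S\<close>. The ideal
  \<open>(x_1, ..., x_k)\<close>, which is the image of \<open>P_1\<close>, consists of the polynomials in which every term
  contains one of these variables.\<close>

definition resolves_variables :: "nat \<Rightarrow> nat \<Rightarrow> 'k::field free_complex \<Rightarrow> bool" where
  "resolves_variables n k P \<longleftrightarrow>
     rk P 0 = 1 \<and> gdeg P 0 0 = 0 \<and> aug P 0 = 1 \<and>
     (\<forall>i. \<forall>b<rk P (Suc i). \<forall>c<rk P i.
        dmat P i b c \<in> S n \<and> homogeneous (gdeg P (Suc i) b - gdeg P i c) (dmat P i b c)) \<and>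
     diff P 0 ` tensor (S n) P 1 =
       {v \<in> tensor (S n) P 0. \<forall>m\<in>Poly_Mapping.keys (v 0). Poly_Mapping.keys m \<inter> {1..k} \<noteq> {}} \<and>
     (\<forall>i. {v \<in> tensor (S n) P (Suc i). diff P i v = 0} = diff P (Suc i) ` tensor (S n) P (Suc (Suc i)))"

definition trivial_complex :: "'k::field free_complex" where
  "trivial_complex = \<lparr>rk = (\<lambda>i. if i = 0 then 1 else 0), gdeg = (\<lambda>_ _. 0), dmat = (\<lambda>_ _ _. 0), aug = (\<lambda>_. 1)\<rparr>"

lemma trivial_complex_resolves: "resolves_variables n 0 (trivial_complex :: 'k::field free_complex)"
proof -
  have t: "tensor (S n) (trivial_complex :: 'k free_complex) (Suc i) = {0}" for i
    unfolding tensor_def trivial_complex_def by (auto simp: fun_eq_iff)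
  have "{v \<in> tensor (S n) (trivial_complex :: 'k free_complex) 0.
      \<forall>m\<in>Poly_Mapping.keys (v 0). Poly_Mapping.keys m \<inter> {1..0} \<noteq> {}} = {0}"
  proof (intro equalityI subsetI)
    fix v :: "nat \<Rightarrow> 'k mpoly"
    assume v: "v \<in> {v \<in> tensor (S n) (trivial_complex :: 'k free_complex) 0.
      \<forall>m\<in>Poly_Mapping.keys (v 0). Poly_Mapping.keys m \<inter> {1..0} \<noteq> {}}"
    then have "Poly_Mapping.keys (v 0) = {}" by auto
    then have "v 0 = 0" by (intro poly_mapping_eqI) (auto simp: in_keys_iff)
    moreover have "v b = 0" if "b \<noteq> 0" for b
      using v that unfolding tensor_def trivial_complex_def by simp
    ultimately have "v b = 0" for b by (cases "b = 0") auto
    then have "v = 0" by (simp add: fun_eq_iff)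
    then show "v \<in> {0}" by simp
  qed (simp add: tensor_zero[OF is_ideal_S])
  moreover have "{v \<in> tensor (S n) (trivial_complex :: 'k free_complex) (Suc i). diff trivial_complex i v = 0}
      = diff trivial_complex (Suc i) ` tensor (S n) trivial_complex (Suc (Suc i))" for i
    unfolding t using diff_zero by auto
  moreover have "diff trivial_complex 0 ` tensor (S n) (trivial_complex :: 'k free_complex) 1 = {0}"
    unfolding One_nat_def t by (simp add: diff_zero)
  moreover have "rk (trivial_complex :: 'k free_complex) i = (if i = 0 then 1 else 0)"
    "gdeg (trivial_complex :: 'k free_complex) 0 0 = 0" "aug (trivial_complex :: 'k free_complex) 0 = 1" for i
    unfolding trivial_complex_def by simp_all
  ultimately show ?thesis unfolding resolves_variables_def by simp
qed

text \<open>The mapping cone of multiplication by \<open>x\<close>, with \<open>P_i \<oplus> P_(i-1)\<close> in position \<open>i\<close> and the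
  differential \<open>(v, w) \<mapsto> (d v + x w, - d w)\<close>. The first summand takes the indices below \<open>rk P i\<close>.
  The degrees of the second one are shifted by 1, the degree of the variable \<open>x\<close>.\<close>

definition cone :: "'k::field mpoly \<Rightarrow> 'k free_complex \<Rightarrow> 'k free_complex" where
  "cone x P = \<lparr>
     rk = (\<lambda>i. case i of 0 \<Rightarrow> rk P 0 | Suc j \<Rightarrow> rk P i + rk P j),
     gdeg = (\<lambda>i b. if b < rk P i then gdeg P i b else gdeg P (i - 1) (b - rk P i) + 1),
     dmat = (\<lambda>i b c.
       if b < rk P (Suc i) then (if c < rk P i then dmat P i b c else 0)
       else if c < rk P i then (if c = b - rk P (Suc i) then x else 0)
       else - dmat P (i - 1) (b - rk P (Suc i)) (c - rk P i)),
     aug = aug P\<rparr>"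

definition join :: "nat \<Rightarrow> (nat \<Rightarrow> 'a) \<Rightarrow> (nat \<Rightarrow> 'a) \<Rightarrow> nat \<Rightarrow> 'a" where
  "join r v w = (\<lambda>b. if b < r then v b else w (b - r))"

lemma join_eq_iff:
  assumes "\<And>b. b \<ge> r \<Longrightarrow> v b = 0" "\<And>b. b \<ge> r \<Longrightarrow> v' b = 0"
  shows "join r v w = join r v' w' \<longleftrightarrow> v = v' \<and> w = w'"
proof
  assume eq: "join r v w = join r v' w'"
  have "v b = v' b" for b using fun_cong[OF eq, of b] assms unfolding join_def by (cases "b < r") auto
  moreover have "w b = w' b" for b using fun_cong[OF eq, of "b + r"] unfolding join_def by simp
  ultimately show "v = v' \<and> w = w'" by blast
qed simp

lemma cone_tensor_Suc:
  "tensor J (cone x P) (Suc i) = {join (rk P (Suc i)) v w | v w. v \<in> tensor J P (Suc i) \<and> w \<in> tensor J P i}"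
proof (intro equalityI subsetI)
  fix z assume z: "z \<in> tensor J (cone x P) (Suc i)"
  define v where "v = (\<lambda>b. if b < rk P (Suc i) then z b else 0)"
  define w where "w = (\<lambda>b. z (b + rk P (Suc i)))"
  have "v \<in> tensor J P (Suc i)" "w \<in> tensor J P i"
    using z unfolding tensor_def cone_def v_def w_def by simp_all
  moreover have "z = join (rk P (Suc i)) v w"
    unfolding join_def v_def w_def by (simp add: fun_eq_iff)
  ultimately show "z \<in> {join (rk P (Suc i)) v w | v w. v \<in> tensor J P (Suc i) \<and> w \<in> tensor J P i}"
    by blast
next
  fix z assume "z \<in> {join (rk P (Suc i)) v w | v w. v \<in> tensor J P (Suc i) \<and> w \<in> tensor J P i}"
  then show "z \<in> tensor J (cone x P) (Suc i)"
    unfolding tensor_def cone_def join_def by auto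
qed

lemma cone_tensor_0: "tensor J (cone x P) 0 = tensor J P 0"
  unfolding tensor_def cone_def by simp

lemma sum_lessThan_add:
  fixes f :: "nat \<Rightarrow> 'a::comm_monoid_add"
  shows "(\<Sum>b<r + q. f b) = (\<Sum>b<r. f b) + (\<Sum>b<q. f (b + r))"
  by (induction q) (simp_all add: add_ac)

lemma cone_diff_0:
  assumes "w \<in> tensor J P 0"
  shows "diff (cone x P) 0 (join (rk P 1) v w) = diff P 0 v + smul x w"
proof
  fix c
  show "diff (cone x P) 0 (join (rk P 1) v w) c = (diff P 0 v + smul x w) c"
  proof (cases "c < rk P 0")
    case True
    then show ?thesis
      unfolding diff_def cone_def join_def smul_def
      by (simp add: sum_lessThan_add if_distrib[of "\<lambda>y. _ * y"] mult.commute cong: if_cong)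
  next
    case False
    then show ?thesis using tensor_outside[OF assms, of c] unfolding diff_def cone_def smul_def by simp
  qed
qed

lemma cone_diff_Suc:
  assumes "w \<in> tensor J P (Suc i)"
  shows "diff (cone x P) (Suc i) (join (rk P (Suc (Suc i))) v w)
    = join (rk P (Suc i)) (diff P (Suc i) v + smul x w) (- diff P i w)"
proof
  fix c
  show "diff (cone x P) (Suc i) (join (rk P (Suc (Suc i))) v w) c
    = join (rk P (Suc i)) (diff P (Suc i) v + smul x w) (- diff P i w) c"
  proof (cases "c < rk P (Suc i)")
    case True
    then show ?thesis
      unfolding diff_def cone_def join_def smul_def
      by (simp add: sum_lessThan_add if_distrib[of "\<lambda>y. _ * y"] mult.commute cong: if_cong)
  next
    case False
    then show ?thesis
      unfolding diff_def cone_def join_def smul_def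
      by (auto simp: sum_lessThan_add sum_negf)
  qed
qed

text \<open>The variable \<open>x = x_(k+1)\<close> is a nonzerodivisor modulo \<open>(x_1, ..., x_k)\<close>. If \<open>(v, w)\<close> is a
  cycle of the cone, then \<open>w\<close> is a cycle of \<open>P\<close>, or, in position 1, \<open>x w\<close> and hence \<open>w\<close> lies in
  \<open>(x_1, ..., x_k)\<close>. In both cases \<open>w = d w'\<close>, then \<open>v + x w'\<close> is a cycle of \<open>P\<close>, and from
  \<open>v + x w' = d v'\<close> one sees that \<open>(v, w)\<close> is the boundary of \<open>(v', - w')\<close>.\<close>

lemma cone_resolves:
  assumes P: "resolves_variables n k P" and k: "Suc k \<le> n"
  shows "resolves_variables n (Suc k) (cone (var (Suc k)) P :: 'k::field free_complex)"
proof -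
  define x where "x = (var (Suc k) :: 'k mpoly)"
  let ?C = "cone x P"
  have keys_x: "Poly_Mapping.keys (x * p) = (+) (sqfree_exponent {Suc k}) ` Poly_Mapping.keys p" for p
    unfolding x_def var_eq by (rule keys_single_mult)
  have x_S: "x \<in> S n" unfolding x_def var_def using k by (intro monomial_in_S) simp
  have x_hom: "homogeneous 1 x" unfolding homogeneous_def x_def var_def by (simp add: mon_deg_def)
  have rk0: "rk P 0 = 1" and gdeg0: "gdeg P 0 0 = 0" and aug0: "aug P 0 = 1"
    and dmat: "\<And>i b c. b < rk P (Suc i) \<Longrightarrow> c < rk P i \<Longrightarrow>
        dmat P i b c \<in> S n \<and> homogeneous (gdeg P (Suc i) b - gdeg P i c) (dmat P i b c)"
    and im0: "diff P 0 ` tensor (S n) P 1 =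
       {v \<in> tensor (S n) P 0. \<forall>m\<in>Poly_Mapping.keys (v 0). Poly_Mapping.keys m \<inter> {1..k} \<noteq> {}}"
    and exact: "\<And>i. {v \<in> tensor (S n) P (Suc i). diff P i v = 0} = diff P (Suc i) ` tensor (S n) P (Suc (Suc i))"
    using P unfolding resolves_variables_def by simp_all
  have dd: "diff P i (diff P (Suc i) v) = 0" if "v \<in> tensor (S n) P (Suc (Suc i))" for i v
    using exact[of i] that by blast
  have dT: "diff P i v \<in> tensor (S n) P i" if "v \<in> tensor (S n) P (Suc i)" for i v
    using that im0 exact[of "i - 1"] by (cases i) auto
  have lift: "\<exists>w\<in>tensor (S n) P (Suc (Suc i)). diff P (Suc i) w = v"
    if "v \<in> tensor (S n) P (Suc i)" "diff P i v = 0" for i v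
  proof -
    have "v \<in> diff P (Suc i) ` tensor (S n) P (Suc (Suc i))" using exact[of i] that by blast
    then show ?thesis by blast
  qed
  have out: "v b = 0" if "v \<in> tensor (S n) P i" "rk P i \<le> b" for v i b
    using that tensor_outside by blast
  have join0: "join (rk P i) v w = 0 \<longleftrightarrow> v = 0 \<and> w = 0" if "v \<in> tensor (S n) P i" for i v w
  proof -
    have "(0 :: nat \<Rightarrow> 'k mpoly) = join (rk P i) 0 0" unfolding join_def by (simp add: fun_eq_iff)
    then show ?thesis using join_eq_iff[of "rk P i" v 0 w 0] out[OF that] by simp
  qed
  note T = tensor_add[OF is_ideal_S] tensor_minus[OF is_ideal_S] tensor_uminus[OF is_ideal_S]
    tensor_smul[OF is_ideal_S x_S] dT
  show ?thesis
    unfolding resolves_variables_def x_def[symmetric]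
  proof (intro conjI allI impI)
    show "rk ?C 0 = 1" "gdeg ?C 0 0 = 0" "aug ?C 0 = 1"
      using rk0 gdeg0 aug0 unfolding cone_def by simp_all
  next
    fix i b c assume b: "b < rk ?C (Suc i)" and c: "c < rk ?C i"
    have low: "i \<noteq> 0 \<and> c - rk P i < rk P (i - 1) \<and> Suc (i - 1) = i" if "\<not> c < rk P i"
      using c that unfolding cone_def by (cases i) auto
    have b': "b - rk P (Suc i) < rk P i" if "\<not> b < rk P (Suc i)"
      using b that unfolding cone_def by simp
    show "dmat ?C i b c \<in> S n"
      using dmat[of b i c] dmat[of "b - rk P (Suc i)" "i - 1" "c - rk P i"] low b' x_S
      unfolding cone_def by (auto simp: zero_in_S intro: uminus_in_S)
    show "homogeneous (gdeg ?C (Suc i) b - gdeg ?C i c) (dmat ?C i b c)"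
      using dmat[of b i c] dmat[of "b - rk P (Suc i)" "i - 1" "c - rk P i"] low b' x_hom
      unfolding cone_def by (auto simp: homogeneous_zero intro: homogeneous_uminus)
  next
    show "diff ?C 0 ` tensor (S n) ?C 1 =
       {v \<in> tensor (S n) ?C 0. \<forall>m\<in>Poly_Mapping.keys (v 0). Poly_Mapping.keys m \<inter> {1..Suc k} \<noteq> {}}"
    proof (intro equalityI subsetI)
      fix z assume "z \<in> diff ?C 0 ` tensor (S n) ?C 1"
      then obtain v w where v: "v \<in> tensor (S n) P 1" and w: "w \<in> tensor (S n) P 0"
        and "z = diff ?C 0 (join (rk P 1) v w)"
        unfolding One_nat_def cone_tensor_Suc by auto
      then have z: "z = diff P 0 v + smul x w" using cone_diff_0[OF w] by simp
      have "diff P 0 v \<in> diff P 0 ` tensor (S n) P 1" using v by blast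
      then have dv: "Poly_Mapping.keys m \<inter> {1..k} \<noteq> {}" if "m \<in> Poly_Mapping.keys (diff P 0 v 0)" for m
        using that unfolding im0 by blast
      have "Poly_Mapping.keys m \<inter> {1..Suc k} \<noteq> {}" if m: "m \<in> Poly_Mapping.keys (z 0)" for m
        using m unfolding z plus_fun_apply smul_def
      proof (rule keys_addE)
        assume "m \<in> Poly_Mapping.keys (diff P 0 v 0)"
        then show ?thesis using dv by force
      next
        assume "m \<in> Poly_Mapping.keys (x * w 0)"
        then have "Suc k \<in> Poly_Mapping.keys m"
          unfolding keys_x by (auto simp: keys_add_monomial keys_squarefree)
        then show ?thesis by auto
      qed
      then show "z \<in> {v \<in> tensor (S n) ?C 0. \<forall>m\<in>Poly_Mapping.keys (v 0). Poly_Mapping.keys m \<inter> {1..Suc k} \<noteq> {}}"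
        using v w unfolding z cone_tensor_0 by (simp add: T)
    next
      fix z assume z: "z \<in> {v \<in> tensor (S n) ?C 0. \<forall>m\<in>Poly_Mapping.keys (v 0). Poly_Mapping.keys m \<inter> {1..Suc k} \<noteq> {}}"
      then have zS: "z 0 \<in> S n" and z_out: "\<And>b. b \<noteq> 0 \<Longrightarrow> z b = 0"
        unfolding cone_tensor_0 unfolding tensor_def using rk0 by simp_all
      \<comment> \<open>The terms without any of \<open>x_1, ..., x_k\<close> are divisible by \<open>x_(k+1)\<close>.\<close>
      define Q where "Q m \<longleftrightarrow> Poly_Mapping.keys m \<inter> {1..k} \<noteq> {}" for m :: "nat \<Rightarrow>\<^sub>0 nat"
      obtain q where q: "part (\<lambda>m. \<not> Q m) (z 0) = x * q"
      proof -
        have "\<exists>l. m = sqfree_exponent {Suc k} + l" if "m \<in> Poly_Mapping.keys (part (\<lambda>m. \<not> Q m) (z 0))" for m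
        proof -
          have "Suc k \<in> Poly_Mapping.keys m"
            using that z unfolding keys_part Q_def by (auto simp: atLeastAtMostSuc_conv)
          then show ?thesis using squarefree_divides[of "{Suc k}" m] by auto
        qed
        then show ?thesis
          using monomial_divides_if_divides_all_terms that unfolding x_def var_eq by blast
      qed
      have qS: "q \<in> S n"
      proof -
        have "x * q \<in> S n" using part_in_S[OF zS] unfolding q[symmetric] .
        then show ?thesis unfolding S_def by (simp add: keys_x keys_add_monomial)
      qed
      define w where "w = (\<lambda>b::nat. if b = 0 then q else 0)"
      define y where "y = (\<lambda>b::nat. if b = 0 then part Q (z 0) else 0)"
      have w: "w \<in> tensor (S n) P 0" unfolding tensor_def w_def using rk0 qS by simp
      have "part Q (z 0) \<in> S n" by (rule part_in_S[OF zS])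
      then have "y \<in> diff P 0 ` tensor (S n) P 1"
        unfolding im0 unfolding tensor_def y_def using rk0 by (auto simp: keys_part Q_def)
      then obtain v where v: "v \<in> tensor (S n) P 1" "y = diff P 0 v" by blast
      have "z b = (y + smul x w) b" for b
        using part_split[of "z 0" Q] z_out[of b] q unfolding y_def w_def smul_def by auto
      then have "z = diff ?C 0 (join (rk P 1) v w)"
        unfolding cone_diff_0[OF w] v(2) by blast
      moreover have "join (rk P 1) v w \<in> tensor (S n) ?C 1"
        unfolding One_nat_def cone_tensor_Suc using v(1) w by auto
      ultimately show "z \<in> diff ?C 0 ` tensor (S n) ?C 1" by blast
    qed
  next
    fix i
    show "{v \<in> tensor (S n) ?C (Suc i). diff ?C i v = 0} = diff ?C (Suc i) ` tensor (S n) ?C (Suc (Suc i))"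
    proof (intro equalityI subsetI)
      fix z assume z: "z \<in> {v \<in> tensor (S n) ?C (Suc i). diff ?C i v = 0}"
      then obtain v w where v: "v \<in> tensor (S n) P (Suc i)" and w: "w \<in> tensor (S n) P i"
        and zvw: "z = join (rk P (Suc i)) v w"
        unfolding cone_tensor_Suc by blast
      have zero: "diff P i v + smul x w = 0 \<and> (\<exists>w'\<in>tensor (S n) P (Suc i). diff P i w' = w)"
      proof (cases i)
        case 0
        have vw: "diff P 0 v + smul x w = 0"
          using z cone_diff_0[of w "S n" P x v] w unfolding zvw 0 by simp
        have "smul x w = diff P 0 (- v)"
          using vw by (simp add: diff_uminus add_eq_0_iff)
        moreover have "- v \<in> tensor (S n) P 1" using v 0 T(3) by auto
        ultimately have xw: "smul x w \<in> diff P 0 ` tensor (S n) P 1" by blast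
        have "Poly_Mapping.keys m \<inter> {1..k} \<noteq> {}" if m: "m \<in> Poly_Mapping.keys (w 0)" for m
        proof -
          have "sqfree_exponent {Suc k} + m \<in> Poly_Mapping.keys (smul x w 0)"
            unfolding smul_def keys_x using m by blast
          then have "Poly_Mapping.keys (sqfree_exponent {Suc k} + m) \<inter> {1..k} \<noteq> {}"
            using xw unfolding im0 by blast
          then show ?thesis by (simp add: keys_add_monomial keys_squarefree Int_Un_distrib2)
        qed
        then have "w \<in> diff P 0 ` tensor (S n) P 1" unfolding im0 using w 0 by blast
        then show ?thesis using vw 0 by auto
      next
        case (Suc j)
        have "join (rk P i) (diff P i v + smul x w) (- diff P j w) = 0"
          using z cone_diff_Suc[of w "S n" P j x v] w unfolding zvw Suc by simp
        moreover have "diff P i v + smul x w \<in> tensor (S n) P i" using v w by (intro T)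
        ultimately have "diff P i v + smul x w = 0" "- diff P j w = 0" using join0 by blast+
        then show ?thesis using lift[of w j] w unfolding Suc by simp
      qed
      then obtain w' where w': "w' \<in> tensor (S n) P (Suc i)" "diff P i w' = w" by blast
      have "diff P i (v + smul x w') = 0"
        using zero w' by (simp add: diff_add diff_smul)
      moreover have "v + smul x w' \<in> tensor (S n) P (Suc i)" using v w' by (intro T)
      ultimately obtain v' where v': "v' \<in> tensor (S n) P (Suc (Suc i))" "diff P (Suc i) v' = v + smul x w'"
        using lift by blast
      have nw': "- w' \<in> tensor (S n) P (Suc i)" using w' by (intro T)
      have "smul x (- w') = - smul x w'" unfolding smul_def by (simp add: fun_eq_iff)
      then have "diff ?C (Suc i) (join (rk P (Suc (Suc i))) v' (- w')) = z"
        unfolding cone_diff_Suc[OF nw'] zvw v' diff_uminus w' by simp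
      moreover have "join (rk P (Suc (Suc i))) v' (- w') \<in> tensor (S n) ?C (Suc (Suc i))"
        unfolding cone_tensor_Suc[of _ _ _ "Suc i"] using v' nw' by blast
      ultimately show "z \<in> diff ?C (Suc i) ` tensor (S n) ?C (Suc (Suc i))" by blast
    next
      fix z assume "z \<in> diff ?C (Suc i) ` tensor (S n) ?C (Suc (Suc i))"
      then obtain v w where v: "v \<in> tensor (S n) P (Suc (Suc i))" and w: "w \<in> tensor (S n) P (Suc i)"
        and "z = diff ?C (Suc i) (join (rk P (Suc (Suc i))) v w)"
        unfolding cone_tensor_Suc by blast
      then have z: "z = join (rk P (Suc i)) (diff P (Suc i) v + smul x w) (- diff P i w)"
        using cone_diff_Suc[OF w] by simp
      have a: "diff P (Suc i) v + smul x w \<in> tensor (S n) P (Suc i)" using v w by (intro T)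
      have b: "- diff P i w \<in> tensor (S n) P i" using w by (intro T)
      have c: "diff P i (diff P (Suc i) v + smul x w) + smul x (- diff P i w) = 0"
        using dd[OF v] unfolding diff_add diff_smul by (simp add: smul_def fun_eq_iff)
      have "diff ?C i z = 0"
      proof (cases i)
        case 0
        then show ?thesis using cone_diff_0[of "- diff P i w" "S n" P x] b c unfolding z by simp
      next
        case (Suc j)
        have "diff P j (- diff P i w) = 0" using dd[of w j] w unfolding Suc diff_uminus by simp
        moreover have "diff ?C i z = join (rk P i)
            (diff P i (diff P (Suc i) v + smul x w) + smul x (- diff P i w)) (- diff P j (- diff P i w))"
          using cone_diff_Suc[of "- diff P i w" "S n" P j x] b unfolding z Suc by simp
        ultimately show ?thesis using c join0[OF tensor_zero[OF is_ideal_S], of i 0] by simp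
      qed
      moreover have "z \<in> tensor (S n) ?C (Suc i)" unfolding cone_tensor_Suc z using a b by blast
      ultimately show "z \<in> {v \<in> tensor (S n) ?C (Suc i). diff ?C i v = 0}" by blast
    qed
  qed
qed

lemma resolution_of_variables_exists:
  "k \<le> n \<Longrightarrow> \<exists>P :: 'k::field free_complex. resolves_variables n k P"
proof (induction k)
  case 0
  then show ?case using trivial_complex_resolves by blast
next
  case (Suc k)
  then show ?case using cone_resolves[of n k] by (meson Suc_leD)
qed

lemma graded_free_resolution_exists: "\<exists>P :: 'k::field free_complex. graded_free_resolution n P"
proof -
  obtain P :: "'k free_complex" where P: "resolves_variables n n P"
    using resolution_of_variables_exists by blast
  have rk0: "rk P 0 = 1" and gdeg0: "gdeg P 0 0 = 0" and aug0: "aug P 0 = 1"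
    and im0: "diff P 0 ` tensor (S n) P 1 =
       {v \<in> tensor (S n) P 0. \<forall>m\<in>Poly_Mapping.keys (v 0). Poly_Mapping.keys m \<inter> {1..n} \<noteq> {}}"
    using P unfolding resolves_variables_def by simp_all
  have aug: "augment P v = Poly_Mapping.lookup (v 0) 0" for v
    unfolding augment_def rk0 using aug0 by simp
  have "c \<in> augment P ` tensor (S n) P 0" for c :: 'k
  proof
    show "c = augment P (\<lambda>b. if b = 0 then const c else 0)"
      unfolding aug const_def by simp
    show "(\<lambda>b. if b = 0 then const c else 0) \<in> tensor (S n) P 0"
      unfolding tensor_def rk0 by (simp add: const_in_S)
  qed
  then have surj: "augment P ` tensor (S n) P 0 = UNIV" by blast
  have "augment P v = 0 \<longleftrightarrow> (\<forall>m\<in>Poly_Mapping.keys (v 0). Poly_Mapping.keys m \<inter> {1..n} \<noteq> {})"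
    if v: "v \<in> tensor (S n) P 0" for v
  proof -
    have "v 0 \<in> S n" using tensorD[OF v] rk0 by simp
    then have "Poly_Mapping.keys m \<inter> {1..n} = Poly_Mapping.keys m" if "m \<in> Poly_Mapping.keys (v 0)" for m
      using that unfolding S_def by blast
    moreover have "Poly_Mapping.keys m = {} \<longleftrightarrow> m = 0" for m :: "nat \<Rightarrow>\<^sub>0 nat"
      by (auto intro!: poly_mapping_eqI simp: in_keys_iff)
    ultimately show ?thesis unfolding aug by (auto simp: in_keys_iff)
  qed
  then have ker: "{v \<in> tensor (S n) P 0. augment P v = 0} = diff P 0 ` tensor (S n) P 1"
    unfolding im0 by blast
  have "graded_free_resolution n P"
    unfolding graded_free_resolution_def zero_fun_def[symmetric]
    using P surj ker gdeg0 rk0 unfolding resolves_variables_def by simp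
  then show ?thesis by blast
qed

section \<open>Squarefree monomial ideals\<close>

text \<open>The squarefree monomial ideals are those of this form for an upward closed \<open>Q\<close>. In terms of
  \<open>Q\<close>, sums and intersections of ideals are disjunctions and conjunctions, and the colon ideal by
  the product of the variables in \<open>U\<close> belongs to \<open>\<lambda>s. Q (U \<union> s)\<close>.\<close>

definition support_ideal :: "nat \<Rightarrow> (nat set \<Rightarrow> bool) \<Rightarrow> 'k::field mpoly set" where
  "support_ideal n Q = {p \<in> S n. \<forall>m\<in>Poly_Mapping.keys p. Q (Poly_Mapping.keys m)}"

lemma homogeneous_ideal_support_ideal:
  assumes up: "\<And>A B. Q A \<Longrightarrow> A \<subseteq> B \<Longrightarrow> Q B"
  shows "homogeneous_ideal n (support_ideal n Q :: 'k::field mpoly set)"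
  unfolding homogeneous_ideal_def is_ideal_def
proof (intro conjI ballI allI)
  show "support_ideal n Q \<subseteq> (S n :: 'k mpoly set)" unfolding support_ideal_def by blast
  show "0 \<in> (support_ideal n Q :: 'k mpoly set)" unfolding support_ideal_def by (simp add: zero_in_S)
  fix p :: "'k mpoly" assume p: "p \<in> support_ideal n Q"
  show "p + q \<in> support_ideal n Q" if "q \<in> support_ideal n Q" for q
    using p that unfolding support_ideal_def by (auto simp: add_in_S elim!: keys_addE)
  show "hcomp d p \<in> support_ideal n Q" for d
    using p unfolding support_ideal_def hcomp_def S_def by (auto simp: keys_part)
next
  fix r p :: "'k mpoly" assume r: "r \<in> S n" and p: "p \<in> support_ideal n Q"
  have "Q (Poly_Mapping.keys m)" if m: "m \<in> Poly_Mapping.keys (r * p)" for m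
  proof -
    obtain a b where "m = a + b" "b \<in> Poly_Mapping.keys p" using m by (rule keys_multE)
    then show ?thesis using p up[of "Poly_Mapping.keys b"] unfolding support_ideal_def
      by (simp add: keys_add_monomial)
  qed
  then show "r * p \<in> support_ideal n Q"
    using r p mult_in_S unfolding support_ideal_def by blast
qed

lemma ideal_gen_squarefree:
  assumes F: "\<And>A. A \<in> F \<Longrightarrow> A \<subseteq> {1..n}"
  shows "ideal_gen n ((\<lambda>A. Poly_Mapping.single (sqfree_exponent A) (1 :: 'k::field)) ` F)
    = support_ideal n (\<lambda>s. \<exists>A\<in>F. A \<subseteq> s)"
proof
  let ?G = "(\<lambda>A. Poly_Mapping.single (sqfree_exponent A) (1 :: 'k)) ` F"
  let ?I = "support_ideal n (\<lambda>s. \<exists>A\<in>F. A \<subseteq> s) :: 'k mpoly set"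
  have fin: "finite A" if "A \<in> F" for A using F[OF that] finite_subset by blast
  have "is_ideal n ?I"
    using homogeneous_ideal_support_ideal[of "\<lambda>s. \<exists>A\<in>F. A \<subseteq> s" n]
    unfolding homogeneous_ideal_def by blast
  moreover have "?G \<subseteq> ?I"
  proof (intro image_subsetI)
    fix A assume A: "A \<in> F"
    show "Poly_Mapping.single (sqfree_exponent A) 1 \<in> ?I"
      using A F[OF A] unfolding support_ideal_def S_def by (auto simp: keys_squarefree[OF fin[OF A]])
  qed
  ultimately show "ideal_gen n ?G \<subseteq> ?I" unfolding ideal_gen_def by blast
  show "?I \<subseteq> ideal_gen n ?G"
    unfolding ideal_gen_def
  proof (intro subsetI InterI)
    fix p J assume p: "p \<in> ?I" and "J \<in> {J. is_ideal n J \<and> ?G \<subseteq> J}"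
    then have J: "is_ideal n J" and GJ: "?G \<subseteq> J" by blast+
    have "Poly_Mapping.single m (Poly_Mapping.lookup p m) \<in> J" if m: "m \<in> Poly_Mapping.keys p" for m
    proof -
      obtain A where A: "A \<in> F" "A \<subseteq> Poly_Mapping.keys m"
        using p m unfolding support_ideal_def by blast
      obtain l where l: "m = sqfree_exponent A + l" using squarefree_divides[OF fin[OF A(1)] A(2)] .
      have "Poly_Mapping.keys l \<subseteq> {1..n}"
        using p m unfolding support_ideal_def S_def l by (force simp: keys_add_monomial)
      then have "Poly_Mapping.single l (Poly_Mapping.lookup p m) * Poly_Mapping.single (sqfree_exponent A) 1 \<in> J"
        using GJ A(1) by (intro ideal_mult[OF J] monomial_in_S) auto
      then show ?thesis unfolding mult_single l by (simp add: add.commute)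
    qed
    then have "(\<Sum>m\<in>Poly_Mapping.keys p. Poly_Mapping.single m (Poly_Mapping.lookup p m)) \<in> J"
      by (rule ideal_sum[OF J])
    also have "(\<Sum>m\<in>Poly_Mapping.keys p. Poly_Mapping.single m (Poly_Mapping.lookup p m)) = p"
      by (intro poly_mapping_eqI) (simp add: lookup_sum lookup_single when_def in_keys_iff)
    finally show "p \<in> J" .
  qed
qed

text \<open>For an upward closed \<open>Q\<close>, with \<open>J\<close> the ideal of \<open>Q\<close> and \<open>w\<close> the product of the variables
  in \<open>U\<close>, this is the identity \<open>(w) \<inter> J = w (J : w)\<close>.\<close>

lemma support_ideal_multiples:
  assumes U: "U \<subseteq> {1..n}"
  shows "support_ideal n (\<lambda>s. U \<subseteq> s \<and> Q s)
    = (*) (Poly_Mapping.single (sqfree_exponent U) (1 :: 'k::field)) ` support_ideal n (\<lambda>s. Q (U \<union> s))"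
proof -
  have fin: "finite U" using U finite_subset by blast
  let ?u = "Poly_Mapping.single (sqfree_exponent U) (1 :: 'k)"
  have mult: "?u * q \<in> support_ideal n (\<lambda>s. U \<subseteq> s \<and> Q s) \<longleftrightarrow> q \<in> support_ideal n (\<lambda>s. Q (U \<union> s))" for q
    unfolding support_ideal_def S_def using U
    by (simp add: keys_single_mult keys_add_monomial keys_squarefree[OF fin])
  have "\<exists>q. p = ?u * q" if p: "p \<in> support_ideal n (\<lambda>s. U \<subseteq> s \<and> Q s)" for p
  proof -
    have "\<exists>l. m = sqfree_exponent U + l" if "m \<in> Poly_Mapping.keys p" for m
      using p that squarefree_divides[OF fin, of m] unfolding support_ideal_def by blast
    then show ?thesis using monomial_divides_if_divides_all_terms by blast
  qed
  then show ?thesis using mult by blast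
qed

lemma support_ideal_sum:
  assumes Q: "\<And>A B. Q A \<Longrightarrow> A \<subseteq> B \<Longrightarrow> Q B" and R: "\<And>A B. R A \<Longrightarrow> A \<subseteq> B \<Longrightarrow> R B"
  shows "support_ideal n (\<lambda>s. Q s \<or> R s)
    = {x + y | x y. x \<in> support_ideal n Q \<and> y \<in> (support_ideal n R :: 'k::field mpoly set)}"
proof (intro equalityI subsetI)
  fix p :: "'k mpoly" assume p: "p \<in> support_ideal n (\<lambda>s. Q s \<or> R s)"
  define T where "T m = Q (Poly_Mapping.keys m)" for m :: "nat \<Rightarrow>\<^sub>0 nat"
  have "part T p \<in> support_ideal n Q" "part (\<lambda>m. \<not> T m) p \<in> support_ideal n R"
    using p unfolding support_ideal_def S_def T_def by (auto simp: keys_part)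
  then show "p \<in> {x + y | x y. x \<in> support_ideal n Q \<and> y \<in> support_ideal n R}"
    using part_split[of p T] by blast
next
  fix p :: "'k mpoly" assume "p \<in> {x + y | x y. x \<in> support_ideal n Q \<and> y \<in> support_ideal n R}"
  then show "p \<in> support_ideal n (\<lambda>s. Q s \<or> R s)"
    unfolding support_ideal_def by (auto simp: add_in_S elim!: keys_addE)
qed

text \<open>The ideal on the left is \<open>X + Y\<close> with \<open>X\<close> generated by the product \<open>u\<close> of the variables in \<open>U\<close>
  and \<open>Y\<close> the ideal of \<open>Q\<close>.
  The assumption \<open>indep\<close> says that \<open>x_a\<close> occurs in no minimal generator of \<open>Y\<close>, and \<open>notQ\<close> that \<open>u\<close>
  is not in \<open>Y\<close>, that is, \<open>Y : u\<close> is a proper ideal. These make the inclusions of \<open>X \<inter> Y\<close> into \<open>Y\<close>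
  and into \<open>X\<close>, respectively, vanish on Tor.\<close>

lemma tor_dim_support_ideal_splitting:
  fixes P :: "'k::field free_complex"
  assumes P: "graded_free_resolution n P"
    and U: "U \<subseteq> {1..n}" and a: "a \<in> U"
    and up: "\<And>A B. Q A \<Longrightarrow> A \<subseteq> B \<Longrightarrow> Q B"
    and indep: "\<And>A. Q (insert a A) \<Longrightarrow> Q A"
    and notQ: "\<not> Q U"
  shows "tor_dim P (support_ideal n (\<lambda>s. U \<subseteq> s \<or> Q s)) (Suc i) t
    = tor_dim P (support_ideal n (\<lambda>s. U \<subseteq> s)) (Suc i) t
      + tor_dim P (support_ideal n Q) (Suc i) t
      + tor_dim P (support_ideal n (\<lambda>s. Q (U \<union> s))) i (t - int (mon_deg (sqfree_exponent U)))"
proof -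
  define X where "X = (support_ideal n (\<lambda>s. U \<subseteq> s) :: 'k mpoly set)"
  define Y where "Y = (support_ideal n Q :: 'k mpoly set)"
  define A where "A = (support_ideal n (\<lambda>s. Q (U \<union> s)) :: 'k mpoly set)"
  define u where "u = Poly_Mapping.single (sqfree_exponent U) (1 :: 'k)"
  define x where "x = (var a :: 'k mpoly)"
  have X: "homogeneous_ideal n X" unfolding X_def by (rule homogeneous_ideal_support_ideal) blast
  have Y: "homogeneous_ideal n Y" unfolding Y_def by (rule homogeneous_ideal_support_ideal[OF up])
  have A: "homogeneous_ideal n A"
    unfolding A_def by (rule homogeneous_ideal_support_ideal) (rule up, assumption, blast)
  have W: "homogeneous_ideal n (support_ideal n (\<lambda>s. U \<subseteq> s \<or> Q s) :: 'k mpoly set)"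
    by (rule homogeneous_ideal_support_ideal) (use up in blast)
  have X': "is_ideal n X" and A': "is_ideal n A" and Y': "is_ideal n Y"
    using X Y A unfolding homogeneous_ideal_def by blast+
  have XY': "is_ideal n (X \<inter> Y)" using X' Y' unfolding is_ideal_def by blast
  have sum: "support_ideal n (\<lambda>s. U \<subseteq> s \<or> Q s) = {x + y | x y. x \<in> X \<and> y \<in> Y}"
    unfolding X_def Y_def by (rule support_ideal_sum) (use up in blast)+
  have "X \<inter> Y = support_ideal n (\<lambda>s. U \<subseteq> s \<and> Q s)"
    unfolding X_def Y_def support_ideal_def by blast
  then have XY: "X \<inter> Y = (*) u ` A"
    unfolding support_ideal_multiples[OF U] u_def A_def .
  have XYx: "X \<inter> Y \<subseteq> (*) x ` Y"
  proof -
    have "X \<inter> Y \<subseteq> support_ideal n (\<lambda>s. {a} \<subseteq> s \<and> Q s)"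
      using a unfolding X_def Y_def support_ideal_def by blast
    also have "\<dots> = (*) x ` support_ideal n (\<lambda>s. Q ({a} \<union> s))"
      unfolding x_def var_eq using a U by (intro support_ideal_multiples) blast
    also have "\<dots> \<subseteq> (*) x ` Y"
      unfolding Y_def support_ideal_def using indep by auto
    finally show ?thesis .
  qed
  have xS: "x \<in> S n" unfolding x_def var_def using a U by (intro monomial_in_S) auto
  have uS: "u \<in> S n" unfolding u_def using U finite_subset[OF U] by (intro monomial_in_S) (simp add: keys_squarefree)
  have x0: "Poly_Mapping.lookup x 0 = 0"
    unfolding x_def var_eq
    by (metis keys_single keys_squarefree finite.emptyI finite_insert insert_not_empty keys_zero
        lookup_single_not_eq)
  have nz: "u \<noteq> 0" "x \<noteq> 0"
    unfolding u_def x_def var_def by (metis single_zero inj_single injD zero_neq_one)+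
  have cancel: "diff P l (smul p w) = 0 \<Longrightarrow> p \<noteq> 0 \<Longrightarrow> diff P l w = 0" for l p w
    unfolding diff_smul by (simp add: smul_def fun_eq_iff)
  have uX: "(*) u ` S n \<subseteq> X"
    using support_ideal_multiples[where 'k = 'k, OF U, of "\<lambda>_. True"]
    unfolding u_def X_def by (simp add: support_ideal_def)
  have zero: "cycles P (X \<inter> Y) k t \<subseteq> boundaries P X k t \<inter> boundaries P Y k t" for k
  proof
    fix z assume z: "z \<in> cycles P (X \<inter> Y) k t"
    have z_tensor: "z \<in> tensor (X \<inter> Y) P k" and z_cyc: "k = 0 \<or> diff P (k - 1) z = 0"
      using z unfolding cycles_def tensor_deg_def zero_fun_def by blast+
    have z_deg: "z \<in> tensor_deg (S n) P k t"
      using z cycles_subset tensor_deg_mono[OF ideal_subset[OF XY']] by blast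
    have "z \<in> boundaries P Y k t"
    proof -
      \<comment> \<open>\<open>z\<close> is \<open>x\<close> times a cycle with coefficients in \<open>Y\<close>.\<close>
      obtain w where w: "w \<in> tensor Y P k" "z = smul x w"
        using z_tensor tensor_mono[OF XYx, of P k] unfolding tensor_image_mult by blast
      then have "k = 0 \<or> diff P (k - 1) w = 0" using z_cyc cancel nz by blast
      then show ?thesis
        using multiple_of_cycle_is_boundary[OF P xS x0 Y w(1)] z_deg unfolding w(2) by blast
    qed
    moreover have "z \<in> boundaries P X k t"
    proof -
      \<comment> \<open>\<open>z = u w\<close>, and \<open>w\<close> bounds in the resolution itself. In position 0 this is because \<open>w\<close> has
        coefficients in the proper ideal \<open>Y : u\<close> and so is killed by the augmentation.\<close>
      obtain w where w: "w \<in> tensor A P k" "z = smul u w"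
        using z_tensor unfolding XY tensor_image_mult by blast
      have wS: "w \<in> tensor (S n) P k" using w tensor_mono[OF ideal_subset[OF A']] by blast
      have cyc: "k = 0 \<or> diff P (k - 1) w = 0" using z_cyc cancel nz w by blast
      have "w \<in> diff P k ` tensor (S n) P (Suc k)"
      proof (cases k)
        case 0
        have "Poly_Mapping.lookup (w b) 0 = 0" if "b < rk P 0" for b
        proof (rule ccontr)
          assume "Poly_Mapping.lookup (w b) 0 \<noteq> 0"
          then have "0 \<in> Poly_Mapping.keys (w b)" by (simp add: in_keys_iff)
          then show False
            using tensorD[OF w(1)] that 0 notQ unfolding A_def support_ideal_def by fastforce
        qed
        then have "augment P w = 0" unfolding augment_def by simp
        then show ?thesis using augment_exact[OF P] wS 0 by auto
      next
        case (Suc l)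
        then have "w \<in> {v \<in> tensor (S n) P (Suc l). diff P l v = 0}" using cyc wS by simp
        then show ?thesis using diff_exact[OF P, of l] Suc by simp
      qed
      then obtain w' where w': "w' \<in> tensor (S n) P (Suc k)" "w = diff P k w'" by blast
      have "smul u w' \<in> tensor X P (Suc k)"
        using w'(1) tensor_mono[OF uX, of P "Suc k"] unfolding tensor_image_mult by blast
      moreover have "z = diff P k (smul u w')" unfolding diff_smul w(2) w'(2) ..
      ultimately show ?thesis using homogeneous_boundary[OF P X] z_deg by blast
    qed
    ultimately show "z \<in> boundaries P X k t \<inter> boundaries P Y k t" by blast
  qed
  have "tor_dim P (X \<inter> Y) i t = tor_dim P A i (t - int (mon_deg (sqfree_exponent U)))"
    using tor_dim_shift[OF P A' XY' XY[unfolded u_def]] .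
  then show ?thesis
    using betti_splitting[OF P X Y W sum zero] unfolding X_def Y_def A_def by simp
qed

corollary betti_support_ideal_splitting:
  assumes U: "U \<subseteq> {1..n}" and a: "a \<in> U"
    and up: "\<And>A B. Q A \<Longrightarrow> A \<subseteq> B \<Longrightarrow> Q B"
    and indep: "\<And>A. Q (insert a A) \<Longrightarrow> Q A"
    and notQ: "\<not> Q U"
  shows "betti n (support_ideal n (\<lambda>s. U \<subseteq> s \<or> Q s) :: 'k::field mpoly set) (Suc i) t
    = betti n (support_ideal n (\<lambda>s. U \<subseteq> s) :: 'k mpoly set) (Suc i) t
      + betti n (support_ideal n Q :: 'k mpoly set) (Suc i) t
      + betti n (support_ideal n (\<lambda>s. Q (U \<union> s)) :: 'k mpoly set) i (t - int (mon_deg (sqfree_exponent U)))"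
proof -
  define P where "P = (SOME P :: 'k free_complex. graded_free_resolution n P)"
  have P: "graded_free_resolution n P"
    unfolding P_def using graded_free_resolution_exists by (rule someI_ex)
  have "betti n J k d = tor_dim P J k d" for J k d
    unfolding betti_def tor_dim_def Let_def P_def ..
  then show ?thesis using tor_dim_support_ideal_splitting[where Q = Q, OF P U a up indep notQ] by simp
qed

section \<open>Ideals of intervals\<close>

definition intervals :: "nat list \<Rightarrow> nat list \<Rightarrow> nat set set" where
  "intervals \<alpha> \<beta> = {{\<alpha> ! k..\<beta> ! k} | k. k < length \<alpha>}"

lemma intervals_Cons: "intervals (a # \<alpha>) (b # \<beta>) = insert {a..b} (intervals \<alpha> \<beta>)"
  unfolding intervals_def by (auto simp: less_Suc_eq_0_disj) (metis nth_Cons_0, metis nth_Cons_Suc)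

lemma intervals_drop:
  assumes "length \<alpha> = length \<beta>" "j \<le> length \<alpha>"
  shows "intervals (drop j \<alpha>) (drop j \<beta>) = (\<lambda>k. {\<alpha> ! k..\<beta> ! k}) ` {j..<length \<alpha>}"
proof (intro equalityI subsetI)
  fix A assume "A \<in> intervals (drop j \<alpha>) (drop j \<beta>)"
  then obtain k where "k < length \<alpha> - j" "A = {\<alpha> ! (j + k)..\<beta> ! (j + k)}"
    unfolding intervals_def using assms by auto
  then show "A \<in> (\<lambda>k. {\<alpha> ! k..\<beta> ! k}) ` {j..<length \<alpha>}"
    by (intro image_eqI[of _ _ "j + k"]) auto
next
  fix A assume "A \<in> (\<lambda>k. {\<alpha> ! k..\<beta> ! k}) ` {j..<length \<alpha>}"
  then obtain k where "j \<le> k" "k < length \<alpha>" "A = {\<alpha> ! k..\<beta> ! k}" by auto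
  then show "A \<in> intervals (drop j \<alpha>) (drop j \<beta>)"
    unfolding intervals_def using assms by (intro CollectI exI[of _ "k - j"]) auto
qed

lemma seq_ideal_eq_support_ideal:
  assumes "\<And>A. A \<in> intervals \<alpha> \<beta> \<Longrightarrow> A \<subseteq> {1..n}"
  shows "seq_ideal n \<alpha> \<beta> = (support_ideal n (\<lambda>s. \<exists>A\<in>intervals \<alpha> \<beta>. A \<subseteq> s) :: 'k::field mpoly set)"
proof -
  have "{interval_monom (\<alpha> ! k) (\<beta> ! k) | k. k < length \<alpha>}
    = (\<lambda>A. Poly_Mapping.single (sqfree_exponent A) (1 :: 'k)) ` intervals \<alpha> \<beta>"
    unfolding intervals_def interval_monom_eq by blast
  then show ?thesis unfolding seq_ideal_def using ideal_gen_squarefree[OF assms] by simp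
qed

lemma overlap_index_bounds:
  assumes "\<alpha> \<noteq> []" "\<alpha> ! 0 \<le> \<beta> ! 0" and sorted: "sorted_wrt (<) \<alpha>"
  shows "1 \<le> overlap_index \<alpha> \<beta>" "overlap_index \<alpha> \<beta> \<le> length \<alpha>"
    and "\<And>k. k < length \<alpha> \<Longrightarrow> \<alpha> ! k \<le> \<beta> ! 0 \<longleftrightarrow> k < overlap_index \<alpha> \<beta>"
proof -
  let ?M = "{i \<in> {1..length \<alpha>}. \<alpha> ! (i - 1) \<le> \<beta> ! 0}"
  define j where "j = overlap_index \<alpha> \<beta>"
  have fin: "finite ?M" by simp
  have 1: "1 \<in> ?M" using assms(1,2) by (cases \<alpha>) auto
  have j: "j \<in> ?M" unfolding j_def overlap_index_def using fin 1 by (intro Max_in) auto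
  have ge: "i \<le> j" if "i \<in> ?M" for i unfolding j_def overlap_index_def using fin that by (rule Max_ge)
  show "1 \<le> overlap_index \<alpha> \<beta>" "overlap_index \<alpha> \<beta> \<le> length \<alpha>" using j unfolding j_def by auto
  fix k assume k: "k < length \<alpha>"
  show "\<alpha> ! k \<le> \<beta> ! 0 \<longleftrightarrow> k < overlap_index \<alpha> \<beta>"
    unfolding j_def[symmetric]
  proof
    assume "\<alpha> ! k \<le> \<beta> ! 0"
    then show "k < j" using ge[of "Suc k"] k by simp
  next
    assume kj: "k < j"
    have "\<alpha> ! k \<le> \<alpha> ! (j - 1)"
    proof (cases "k = j - 1")
      case False
      then have "k < j - 1" "j - 1 < length \<alpha>" using kj j by auto
      then show ?thesis using sorted_wrt_nth_less[OF sorted, of k "j - 1"] by simp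
    qed simp
    then show "\<alpha> ! k \<le> \<beta> ! 0" using j by simp
  qed
qed

theorem proposition2p3:
  fixes n s j i :: nat and t :: int and \<alpha> \<beta> :: "nat list"
    and u :: "'k::field mpoly" and I Ibar I' I'' :: "'k mpoly set"
  assumes "1 \<le> n" and "2 \<le> s" and "s \<le> n"
    and "length \<alpha> = s" and "length \<beta> = s"
    and "sorted_wrt (<) \<alpha>" and "sorted_wrt (<) \<beta>"
    and "1 \<le> \<alpha> ! 0" and "\<beta> ! (s - 1) \<le> n"
    and "\<forall>k<s. \<alpha> ! k \<le> \<beta> ! k"
    and "j = overlap_index \<alpha> \<beta>"
    and "u = interval_monom (\<alpha> ! 0) (\<beta> ! 0)"
    and "I = seq_ideal n \<alpha> \<beta>"
    and "Ibar = seq_ideal n (tl \<alpha>) (tl \<beta>)"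
    and "I' = seq_ideal n (alpha' \<alpha> \<beta>) (beta' \<alpha> \<beta>)"
    and "j > 1 \<longrightarrow> I'' = seq_ideal n (alpha'' \<alpha> \<beta>) (beta'' \<alpha> \<beta>)"
    and "i > 0" and "t > 0"
  shows "(j = 1 \<longrightarrow>
            betti n I i t =
              betti n (ideal_gen n {u}) i t + betti n I' i t
                + betti n I' (i - 1) (t - int (poly_deg u))) \<and>
         (j > 1 \<longrightarrow>
            betti n I i t =
              betti n (ideal_gen n {u}) i t + betti n Ibar i t
                + betti n I'' (i - 1) (t - int (poly_deg u)))"
proof -
  note len = \<open>length \<alpha> = s\<close> \<open>length \<beta> = s\<close>
  have a_less: "\<alpha> ! k < \<alpha> ! l" and b_less: "\<beta> ! k < \<beta> ! l" if "k < l" "l < s" for k l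
    using sorted_wrt_nth_less[OF \<open>sorted_wrt (<) \<alpha>\<close>] sorted_wrt_nth_less[OF \<open>sorted_wrt (<) \<beta>\<close>] that len
    by simp_all
  have a_ge: "1 \<le> \<alpha> ! k" if "k < s" for k
    using a_less[of 0 k] that \<open>1 \<le> \<alpha> ! 0\<close> by (cases "k = 0") auto
  have b_le: "\<beta> ! k \<le> n" if "k < s" for k
  proof (cases "k = s - 1")
    case False
    then have "k < s - 1" "s - 1 < s" using that by auto
    then show ?thesis using b_less[of k "s - 1"] \<open>\<beta> ! (s - 1) \<le> n\<close> by linarith
  qed (use \<open>\<beta> ! (s - 1) \<le> n\<close> in simp)
  have ab: "\<alpha> ! k \<le> \<beta> ! k" if "k < s" for k using that assms(10) by blast
  have "\<alpha> \<noteq> []" "\<alpha> ! 0 \<le> \<beta> ! 0" using len \<open>2 \<le> s\<close> ab by auto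
  note ov = overlap_index_bounds[OF this \<open>sorted_wrt (<) \<alpha>\<close>, folded \<open>j = overlap_index \<alpha> \<beta>\<close>, unfolded len]
  define U where "U = {\<alpha> ! 0..\<beta> ! 0}"
  define Q where "Q s' \<longleftrightarrow> (\<exists>A\<in>intervals (tl \<alpha>) (tl \<beta>). A \<subseteq> s')" for s'
  have tl_intervals: "intervals (tl \<alpha>) (tl \<beta>) = (\<lambda>k. {\<alpha> ! k..\<beta> ! k}) ` {1..<s}"
    using intervals_drop[of \<alpha> \<beta> 1] len \<open>2 \<le> s\<close> by (simp add: drop_Suc)
  have Q_iff: "Q s' \<longleftrightarrow> (\<exists>k. 1 \<le> k \<and> k < s \<and> {\<alpha> ! k..\<beta> ! k} \<subseteq> s')" for s'
    unfolding Q_def tl_intervals by (simp add: Bex_def conj_assoc)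
  have in_range: "{\<alpha> ! k..\<beta> ! k} \<subseteq> {1..n}" if "k < s" for k
    using a_ge[OF that] b_le[OF that] by auto
  have all_intervals: "intervals \<alpha> \<beta> = insert U (intervals (tl \<alpha>) (tl \<beta>))"
    using intervals_Cons[of "hd \<alpha>" "tl \<alpha>" "hd \<beta>" "tl \<beta>"] len \<open>2 \<le> s\<close> unfolding U_def
    by (cases \<alpha>; cases \<beta>) auto
  have I: "I = support_ideal n (\<lambda>s'. U \<subseteq> s' \<or> Q s')"
  proof -
    have "I = support_ideal n (\<lambda>s'. \<exists>A\<in>intervals \<alpha> \<beta>. A \<subseteq> s')"
      unfolding assms(13) using in_range len unfolding intervals_def
      by (intro seq_ideal_eq_support_ideal[unfolded intervals_def]) blast
    then show ?thesis unfolding all_intervals Q_def by simp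
  qed
  have Ibar: "Ibar = support_ideal n Q"
    unfolding assms(14) Q_def
  proof (rule seq_ideal_eq_support_ideal)
    fix A assume "A \<in> intervals (tl \<alpha>) (tl \<beta>)"
    then obtain k where "k < s" "A = {\<alpha> ! k..\<beta> ! k}" unfolding tl_intervals by auto
    then show "A \<subseteq> {1..n}" using in_range by blast
  qed
  have U_range: "U \<subseteq> {1..n}" unfolding U_def using in_range[of 0] \<open>2 \<le> s\<close> by simp
  have u: "u = Poly_Mapping.single (sqfree_exponent U) 1"
    unfolding U_def assms(12) by (rule interval_monom_eq)
  have ideal_u: "ideal_gen n {u} = support_ideal n (\<lambda>s'. U \<subseteq> s')"
    using ideal_gen_squarefree[of "{U}" n] U_range unfolding u by simp
  obtain i' where i': "i = Suc i'" using \<open>i > 0\<close> by (cases i) auto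
  have splitting: "betti n I i t = betti n (ideal_gen n {u}) i t + betti n Ibar i t
    + betti n (support_ideal n (\<lambda>s'. Q (U \<union> s')) :: 'k mpoly set) (i - 1) (t - int (poly_deg u))"
    unfolding I Ibar ideal_u i' diff_Suc_1 unfolding u poly_deg_monomial
  proof (rule betti_support_ideal_splitting[OF U_range])
    show "\<alpha> ! 0 \<in> U" unfolding U_def using ab[of 0] \<open>2 \<le> s\<close> by simp
    show "Q B" if "Q A" "A \<subseteq> B" for A B using that unfolding Q_def by blast
    show "Q A" if "Q (insert (\<alpha> ! 0) A)" for A
    proof -
      obtain k where k: "1 \<le> k" "k < s" "{\<alpha> ! k..\<beta> ! k} \<subseteq> insert (\<alpha> ! 0) A"
        using \<open>Q (insert (\<alpha> ! 0) A)\<close> unfolding Q_iff by blast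
      have "\<alpha> ! 0 \<notin> {\<alpha> ! k..\<beta> ! k}" using a_less[of 0 k] k by simp
      then show ?thesis using k unfolding Q_iff by blast
    qed
    show "\<not> Q U"
    proof
      assume "Q U"
      then obtain k where k: "1 \<le> k" "k < s" "{\<alpha> ! k..\<beta> ! k} \<subseteq> U" unfolding Q_iff by blast
      then have "\<beta> ! k \<in> U" using ab[of k] by auto
      then show False unfolding U_def using b_less[of 0 k] k by simp
    qed
  qed
  have drop_intervals: "intervals (drop l \<alpha>) (drop l \<beta>) = (\<lambda>k. {\<alpha> ! k..\<beta> ! k}) ` {l..<s}"
    if "l \<le> s" for l
    using intervals_drop[of \<alpha> \<beta> l] len that by simp
  \<comment> \<open>It remains to identify the colon ideal of \<open>Ibar\<close> by \<open>u\<close>. For \<open>j = 1\<close> the later intervals are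
    disjoint from \<open>U\<close>, so it is \<open>Ibar\<close>.\<close>
  have colon1: "I' = Ibar \<and> I' = support_ideal n (\<lambda>s'. Q (U \<union> s'))" if j1: "j = 1"
  proof -
    have "I' = Ibar"
      unfolding assms(15) assms(14) alpha'_def beta'_def
      using j1 \<open>j = overlap_index \<alpha> \<beta>\<close> by (simp add: drop_Suc)
    moreover have "Q (U \<union> s') \<longleftrightarrow> Q s'" for s'
    proof -
      have "{\<alpha> ! k..\<beta> ! k} \<subseteq> U \<union> s' \<longleftrightarrow> {\<alpha> ! k..\<beta> ! k} \<subseteq> s'" if "1 \<le> k" "k < s" for k
        using ov(3)[of k] that j1 unfolding U_def by auto
      then show ?thesis unfolding Q_iff by blast
    qed
    ultimately show ?thesis unfolding Ibar by simp
  qed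
  have colon2: "I'' = support_ideal n (\<lambda>s'. Q (U \<union> s'))" if j1: "j > 1"
  proof -
    \<comment> \<open>What is left of the second interval outside \<open>U\<close>. It is contained in what is left of each
      later interval that meets \<open>U\<close>.\<close>
    define B where "B = {\<beta> ! 0 + 1..\<beta> ! 1}"
    have Q_colon: "Q (U \<union> s') \<longleftrightarrow> B \<subseteq> s' \<or> (\<exists>k. j \<le> k \<and> k < s \<and> {\<alpha> ! k..\<beta> ! k} \<subseteq> s')" for s'
    proof
      assume "Q (U \<union> s')"
      then obtain k where k: "1 \<le> k" "k < s" "{\<alpha> ! k..\<beta> ! k} \<subseteq> U \<union> s'" unfolding Q_iff by blast
      show "B \<subseteq> s' \<or> (\<exists>k. j \<le> k \<and> k < s \<and> {\<alpha> ! k..\<beta> ! k} \<subseteq> s')"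
      proof (cases "k < j")
        case True
        have "\<beta> ! 1 \<le> \<beta> ! k" using b_less[of 1 k] k by (cases "k = 1") auto
        then have "B \<subseteq> {\<alpha> ! k..\<beta> ! k} - U"
          using ov(3)[of k] True k unfolding B_def U_def by auto
        then show ?thesis using k by blast
      next
        case False
        then have "{\<alpha> ! k..\<beta> ! k} \<inter> U = {}" using ov(3)[of k] k unfolding U_def by auto
        then show ?thesis using False k by (intro disjI2 exI[of _ k]) auto
      qed
    next
      assume "B \<subseteq> s' \<or> (\<exists>k. j \<le> k \<and> k < s \<and> {\<alpha> ! k..\<beta> ! k} \<subseteq> s')"
      then show "Q (U \<union> s')"
      proof
        assume B: "B \<subseteq> s'"
        have "{\<alpha> ! 1..\<beta> ! 1} \<subseteq> U \<union> B"
          using a_less[of 0 1] \<open>2 \<le> s\<close> unfolding U_def B_def by auto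
        then show ?thesis unfolding Q_iff using B \<open>2 \<le> s\<close> by (intro exI[of _ 1]) auto
      next
        assume "\<exists>k. j \<le> k \<and> k < s \<and> {\<alpha> ! k..\<beta> ! k} \<subseteq> s'"
        then obtain k where "j \<le> k" "k < s" "{\<alpha> ! k..\<beta> ! k} \<subseteq> s'" by blast
        then show ?thesis unfolding Q_iff using j1 by (intro exI[of _ k]) auto
      qed
    qed
    have B_range: "B \<subseteq> {1..n}" unfolding B_def using b_le[of 1] \<open>2 \<le> s\<close> by auto
    let ?F = "intervals (alpha'' \<alpha> \<beta>) (beta'' \<alpha> \<beta>)"
    let ?T = "\<lambda>l. (\<lambda>k. {\<alpha> ! k..\<beta> ! k}) ` {l..<s}"
    have F: "?F \<subseteq> insert B (?T j) \<and> (\<forall>s'. (\<exists>A\<in>?F. A \<subseteq> s') \<longleftrightarrow> (\<exists>A\<in>insert B (?T j). A \<subseteq> s'))"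
    proof (cases "j < s")
      case False
      then have "?F = insert B (?T j)"
        unfolding alpha''_def beta''_def B_def \<open>j = overlap_index \<alpha> \<beta>\<close>[symmetric] Let_def
        using len by (simp add: intervals_def)
      then show ?thesis by simp
    next
      case True
      show ?thesis
      proof (cases "\<alpha> ! j > \<beta> ! 0 + 1")
        case gap: True
        have "?F = insert B (?T j)"
          unfolding alpha''_def beta''_def B_def \<open>j = overlap_index \<alpha> \<beta>\<close>[symmetric] Let_def
          using len True gap by (simp add: intervals_Cons drop_intervals)
        then show ?thesis by simp
      next
        case False
        \<comment> \<open>Here the interval from \<open>\<alpha> ! j\<close> starts where \<open>B\<close> does and ends later, which is why
          \<open>alpha''\<close> and \<open>beta''\<close> leave it out.\<close>
        have F: "?F = insert B (?T (Suc j))"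
          unfolding alpha''_def beta''_def B_def \<open>j = overlap_index \<alpha> \<beta>\<close>[symmetric] Let_def
          using len True False drop_intervals[of "Suc j"] by (simp add: intervals_Cons)
        have "\<alpha> ! j = \<beta> ! 0 + 1" using ov(3)[of j] True False by simp
        then have redundant: "B \<subseteq> {\<alpha> ! j..\<beta> ! j}"
          unfolding B_def using b_less[of 1 j] True j1 by auto
        have "{j..<s} = insert j {Suc j..<s}" using True by auto
        then have "?T j = insert {\<alpha> ! j..\<beta> ! j} (?T (Suc j))" by simp
        moreover have "(\<exists>A\<in>insert B T'. A \<subseteq> s') \<longleftrightarrow> (\<exists>A\<in>insert B (insert {\<alpha> ! j..\<beta> ! j} T'). A \<subseteq> s')"
          for T' s' using redundant by (simp, meson order_trans)
        ultimately show ?thesis unfolding F by (simp only: subset_insertI insert_mono simp_thms)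
      qed
    qed
    have T_range: "A \<subseteq> {1..n}" if "A \<in> insert B (?T j)" for A
      using that
    proof
      assume "A \<in> ?T j"
      then obtain k where "k < s" "A = {\<alpha> ! k..\<beta> ! k}" by auto
      then show ?thesis using in_range by blast
    qed (use B_range in simp)
    have "I'' = seq_ideal n (alpha'' \<alpha> \<beta>) (beta'' \<alpha> \<beta>)" using j1 assms(16) by blast
    also have "\<dots> = support_ideal n (\<lambda>s'. \<exists>A\<in>?F. A \<subseteq> s')"
      using F T_range by (intro seq_ideal_eq_support_ideal) blast
    also have "\<dots> = support_ideal n (\<lambda>s'. Q (U \<union> s'))"
    proof -
      have "(\<exists>A\<in>insert B (?T j). A \<subseteq> s') \<longleftrightarrow> Q (U \<union> s')" for s'
        unfolding Q_colon by (simp, metis atLeastLessThan_iff)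
      then show ?thesis using F by simp
    qed
    finally show ?thesis .
  qed
  show ?thesis using splitting colon1 colon2 by auto
qed

end
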